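(* Let $\mathcal{C}$ be a model category. Suppose there is a set $I$ of generating cofibrations which have categorically finite domains. Let $Y\in\mathcal{C}$ be an object. If $Y$ is categorically finite and cofibrant, then $Y$ is a retract of an object $Z$ which is a finite $CW$ object in the following sense: there is a finite filtration $$*=Z_0\to Z_1\to\cdots\to Z_n=Z$$ where each map $Z_k\to Z_{k+1}$ is a pushout of a single map in $I$, and $*$ denotes the initial object of $\mathcal{C}$. Conversely, if $Y$ is a retract of a finite $CW$ object $Z$ (that is, an object $Z$ admitting a finite filtration $*=Z_0\to Z_1\to\cdots\to Z_n=Z$ starting at the initial object $*$ of $\mathcal{C}$, where each map $Z_k\to Z_{k+1}$ is a pushout of a single map in $I$), and if the maps in $I$ have categorically finite domain and codomain, then $Y$ is categorically finite and cofibrant.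
   Context: An object $Y$ of a cocomplete category $\mathcal{C}$ is called categorically finite if the representable functor $\mathcal{C}(Y,\,\cdot\,)$ commutes with filtered colimits. A set $I$ of generating cofibrations of a model category is meant in the usual sense of cofibrantly generated model categories (the small object argument applies to $I$, and the acyclic fibrations are precisely the maps having the right lifting property with respect to $I$). *)

theory Defs
  imports Main
begin

unbundle cardinal_syntax

text \<open>
  Size convention. ``Small'' always means ``of cardinality less than \<open>\<kappa>\<close>'', where \<open>\<kappa>\<close> is a fixed
  uncountable regular cardinal. The usual reading (sets inside a Grothendieck universe) is the
  case that \<open>\<kappa>\<close> is inaccessible; the strong limit property is not required. Since \<open>\<kappa>\<close> lives on
  the type \<open>'k\<close>, every small category is isomorphic to one whose objects and arrows are
  elements of \<open>'k\<close>, and every ordinal below \<open>\<kappa>\<close> is represented by a well-order on a subset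
  of \<open>'k\<close>, so it suffices to quantify over those.
\<close>

definition size_cardinal :: "'k rel \<Rightarrow> bool" where
  "size_cardinal \<kappa> \<longleftrightarrow> Card_order \<kappa> \<and> regularCard \<kappa> \<and> natLeq <o \<kappa>"


section \<open>Categories\<close>

record ('o, 'a) cat =
  Ob :: "'o set"
  Mor :: "'a set"
  src :: "'a \<Rightarrow> 'o"
  tgt :: "'a \<Rightarrow> 'o"
  ide :: "'o \<Rightarrow> 'a"
  cmp :: "'a \<Rightarrow> 'a \<Rightarrow> 'a"  (infixr "\<cdot>\<index>" 75)

definition hom :: "('o, 'a) cat \<Rightarrow> 'o \<Rightarrow> 'o \<Rightarrow> 'a set" where
  "hom C X Y = {f \<in> Mor C. src C f = X \<and> tgt C f = Y}"

locale category =
  fixes C :: "('o, 'a) cat" (structure)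
  assumes src_in_Ob: "f \<in> Mor C \<Longrightarrow> src C f \<in> Ob C"
    and tgt_in_Ob: "f \<in> Mor C \<Longrightarrow> tgt C f \<in> Ob C"
    and ide_in_hom: "X \<in> Ob C \<Longrightarrow> ide C X \<in> hom C X X"
    and cmp_in_hom: "f \<in> hom C X Y \<Longrightarrow> g \<in> hom C Y Z \<Longrightarrow> g \<cdot> f \<in> hom C X Z"
    and cmp_ide: "f \<in> hom C X Y \<Longrightarrow> f \<cdot> ide C X = f"
    and ide_cmp: "f \<in> hom C X Y \<Longrightarrow> ide C Y \<cdot> f = f"
    and cmp_assoc: "f \<in> hom C X Y \<Longrightarrow> g \<in> hom C Y Z \<Longrightarrow> h \<in> hom C Z V
      \<Longrightarrow> (h \<cdot> g) \<cdot> f = h \<cdot> (g \<cdot> f)"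

definition op_cat :: "('o, 'a) cat \<Rightarrow> ('o, 'a) cat" where
  "op_cat C = \<lparr>Ob = Ob C, Mor = Mor C, src = tgt C, tgt = src C, ide = ide C,
     cmp = (\<lambda>g f. cmp C f g)\<rparr>"

definition small_category :: "'k rel \<Rightarrow> ('j, 'b) cat \<Rightarrow> bool" where
  "small_category \<kappa> J \<longleftrightarrow> category J \<and> |Ob J| <o \<kappa> \<and> |Mor J| <o \<kappa>"

definition locally_small :: "'k rel \<Rightarrow> ('o, 'a) cat \<Rightarrow> bool" where
  "locally_small \<kappa> C \<longleftrightarrow> (\<forall>X\<in>Ob C. \<forall>Y\<in>Ob C. |hom C X Y| <o \<kappa>)"

text \<open>A functor is given by its object part \<open>Fo\<close> and its arrow part \<open>Fa\<close>.\<close>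

definition cat_functor ::
  "('j, 'b) cat \<Rightarrow> ('o, 'a) cat \<Rightarrow> ('j \<Rightarrow> 'o) \<Rightarrow> ('b \<Rightarrow> 'a) \<Rightarrow> bool" where
  "cat_functor J C Fo Fa \<longleftrightarrow>
     (\<forall>j\<in>Ob J. Fo j \<in> Ob C \<and> Fa (ide J j) = ide C (Fo j)) \<and>
     (\<forall>i\<in>Ob J. \<forall>j\<in>Ob J. \<forall>u\<in>hom J i j. Fa u \<in> hom C (Fo i) (Fo j)) \<and>
     (\<forall>i\<in>Ob J. \<forall>j\<in>Ob J. \<forall>k\<in>Ob J. \<forall>u\<in>hom J i j. \<forall>v\<in>hom J j k.
        Fa (cmp J v u) = cmp C (Fa v) (Fa u))"


section \<open>Limits and colimits\<close>

definition cocone :: "('j, 'b) cat \<Rightarrow> ('o, 'a) cat \<Rightarrow> ('j \<Rightarrow> 'o) \<Rightarrow> ('b \<Rightarrow> 'a)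
    \<Rightarrow> 'o \<Rightarrow> ('j \<Rightarrow> 'a) \<Rightarrow> bool" where
  "cocone J C Fo Fa L \<iota> \<longleftrightarrow> L \<in> Ob C \<and>
     (\<forall>j\<in>Ob J. \<iota> j \<in> hom C (Fo j) L) \<and>
     (\<forall>i\<in>Ob J. \<forall>j\<in>Ob J. \<forall>u\<in>hom J i j. cmp C (\<iota> j) (Fa u) = \<iota> i)"

definition is_colimit :: "('j, 'b) cat \<Rightarrow> ('o, 'a) cat \<Rightarrow> ('j \<Rightarrow> 'o) \<Rightarrow> ('b \<Rightarrow> 'a)
    \<Rightarrow> 'o \<Rightarrow> ('j \<Rightarrow> 'a) \<Rightarrow> bool" where
  "is_colimit J C Fo Fa L \<iota> \<longleftrightarrow> cocone J C Fo Fa L \<iota> \<and>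
     (\<forall>L' \<iota>'. cocone J C Fo Fa L' \<iota>' \<longrightarrow>
        (\<exists>!h. h \<in> hom C L L' \<and> (\<forall>j\<in>Ob J. cmp C h (\<iota> j) = \<iota>' j)))"

definition cocomplete :: "'k rel \<Rightarrow> ('o, 'a) cat \<Rightarrow> bool" where
  "cocomplete \<kappa> C \<longleftrightarrow>
     (\<forall>(J :: ('k, 'k) cat) Fo Fa. small_category \<kappa> J \<and> cat_functor J C Fo Fa
        \<longrightarrow> (\<exists>L \<iota>. is_colimit J C Fo Fa L \<iota>))"

text \<open>Limits in \<open>C\<close> are colimits in the opposite category.\<close>

definition complete :: "'k rel \<Rightarrow> ('o, 'a) cat \<Rightarrow> bool" where
  "complete \<kappa> C \<longleftrightarrow> cocomplete \<kappa> (op_cat C)"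

definition initial :: "('o, 'a) cat \<Rightarrow> 'o \<Rightarrow> bool" where
  "initial C Z \<longleftrightarrow> Z \<in> Ob C \<and> (\<forall>X\<in>Ob C. \<exists>!f. f \<in> hom C Z X)"

text \<open>
  \<open>is_pushout C i f g h\<close>: in the commutative square with left side \<open>i : A \<rightarrow> B\<close>, top \<open>g : A \<rightarrow> X\<close>,
  bottom \<open>h : B \<rightarrow> X'\<close>, the right side \<open>f : X \<rightarrow> X'\<close> is the pushout of \<open>i\<close> along \<open>g\<close>.
\<close>

definition is_pushout :: "('o, 'a) cat \<Rightarrow> 'a \<Rightarrow> 'a \<Rightarrow> 'a \<Rightarrow> 'a \<Rightarrow> bool" where
  "is_pushout C i f g h \<longleftrightarrow>
     i \<in> Mor C \<and> f \<in> Mor C \<and>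
     g \<in> hom C (src C i) (src C f) \<and> h \<in> hom C (tgt C i) (tgt C f) \<and>
     cmp C f g = cmp C h i \<and>
     (\<forall>T. \<forall>p\<in>hom C (src C f) T. \<forall>q\<in>hom C (tgt C i) T. cmp C p g = cmp C q i \<longrightarrow>
        (\<exists>!t. t \<in> hom C (tgt C f) T \<and> cmp C t f = p \<and> cmp C t h = q))"

definition pushout_of :: "('o, 'a) cat \<Rightarrow> 'a \<Rightarrow> 'a \<Rightarrow> bool" where
  "pushout_of C i f \<longleftrightarrow> (\<exists>g h. is_pushout C i f g h)"


section \<open>Categorically finite objects\<close>

definition filtered :: "('j, 'b) cat \<Rightarrow> bool" where
  "filtered J \<longleftrightarrow> Ob J \<noteq> {} \<and>
     (\<forall>i\<in>Ob J. \<forall>j\<in>Ob J. \<exists>k\<in>Ob J. hom J i k \<noteq> {} \<and> hom J j k \<noteq> {}) \<and>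
     (\<forall>i\<in>Ob J. \<forall>j\<in>Ob J. \<forall>u\<in>hom J i j. \<forall>v\<in>hom J i j.
        \<exists>k\<in>Ob J. \<exists>w\<in>hom J j k. cmp J w u = cmp J w v)"

text \<open>
  The colimit in sets of the diagram \<open>j \<mapsto> C(Y, F j)\<close>: the quotient of the disjoint union
  of the sets \<open>C(Y, F j)\<close> by the equivalence relation generated by \<open>(i, f) \<sim> (j, F u \<cdot> f)\<close>
  for \<open>u : i \<rightarrow> j\<close>.
\<close>

definition hom_union :: "('o, 'a) cat \<Rightarrow> 'o \<Rightarrow> ('j, 'b) cat \<Rightarrow> ('j \<Rightarrow> 'o) \<Rightarrow> ('j \<times> 'a) set" where
  "hom_union C Y J Fo = (SIGMA j:Ob J. hom C Y (Fo j))"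

definition hom_step :: "('o, 'a) cat \<Rightarrow> 'o \<Rightarrow> ('j, 'b) cat \<Rightarrow> ('j \<Rightarrow> 'o) \<Rightarrow> ('b \<Rightarrow> 'a)
    \<Rightarrow> ('j \<times> 'a) rel" where
  "hom_step C Y J Fo Fa = {((i, f), (j, cmp C (Fa u) f)) | i j u f.
     i \<in> Ob J \<and> j \<in> Ob J \<and> u \<in> hom J i j \<and> f \<in> hom C Y (Fo i)}"

definition hom_colim :: "('o, 'a) cat \<Rightarrow> 'o \<Rightarrow> ('j, 'b) cat \<Rightarrow> ('j \<Rightarrow> 'o) \<Rightarrow> ('b \<Rightarrow> 'a)
    \<Rightarrow> ('j \<times> 'a) set set" where
  "hom_colim C Y J Fo Fa =
     hom_union C Y J Fo // Restr ((hom_step C Y J Fo Fa \<union> (hom_step C Y J Fo Fa)\<inverse>)\<^sup>*) (hom_union C Y J Fo)"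

text \<open>
  The canonical map \<open>colim C(Y, F j) \<rightarrow> C(Y, L)\<close>, sending the class of \<open>(j, f)\<close> to \<open>\<iota> j \<cdot> f\<close>.
  On a cocone, \<open>\<iota> j \<cdot> f\<close> is constant on each class, so \<open>the_elem\<close> picks this value.
\<close>

definition hom_colim_map :: "('o, 'a) cat \<Rightarrow> ('j \<Rightarrow> 'a) \<Rightarrow> ('j \<times> 'a) set \<Rightarrow> 'a" where
  "hom_colim_map C \<iota> E = the_elem ((\<lambda>(j, f). cmp C (\<iota> j) f) ` E)"

definition hom_commutes_with :: "('o, 'a) cat \<Rightarrow> 'o \<Rightarrow> ('j, 'b) cat \<Rightarrow> ('j \<Rightarrow> 'o) \<Rightarrow> ('b \<Rightarrow> 'a)
    \<Rightarrow> 'o \<Rightarrow> ('j \<Rightarrow> 'a) \<Rightarrow> bool" where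
  "hom_commutes_with C Y J Fo Fa L \<iota> \<longleftrightarrow>
     bij_betw (hom_colim_map C \<iota>) (hom_colim C Y J Fo Fa) (hom C Y L)"

definition categorically_finite :: "'k rel \<Rightarrow> ('o, 'a) cat \<Rightarrow> 'o \<Rightarrow> bool" where
  "categorically_finite \<kappa> C Y \<longleftrightarrow> Y \<in> Ob C \<and>
     (\<forall>(J :: ('k, 'k) cat) Fo Fa L \<iota>.
        small_category \<kappa> J \<and> filtered J \<and> cat_functor J C Fo Fa \<and> is_colimit J C Fo Fa L \<iota>
        \<longrightarrow> hom_commutes_with C Y J Fo Fa L \<iota>)"


section \<open>Retracts, lifting, model categories\<close>

definition retract :: "('o, 'a) cat \<Rightarrow> 'o \<Rightarrow> 'o \<Rightarrow> bool" where
  "retract C Y Z \<longleftrightarrow> Y \<in> Ob C \<and> Z \<in> Ob C \<and>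
     (\<exists>s\<in>hom C Y Z. \<exists>r\<in>hom C Z Y. cmp C r s = ide C Y)"

definition retract_map :: "('o, 'a) cat \<Rightarrow> 'a \<Rightarrow> 'a \<Rightarrow> bool" where
  "retract_map C f g \<longleftrightarrow> f \<in> Mor C \<and> g \<in> Mor C \<and>
     (\<exists>s\<in>hom C (src C f) (src C g). \<exists>r\<in>hom C (src C g) (src C f).
      \<exists>s'\<in>hom C (tgt C f) (tgt C g). \<exists>r'\<in>hom C (tgt C g) (tgt C f).
        cmp C r s = ide C (src C f) \<and> cmp C r' s' = ide C (tgt C f) \<and>
        cmp C g s = cmp C s' f \<and> cmp C f r = cmp C r' g)"

text \<open>\<open>has_lift C i p\<close>: \<open>i\<close> has the left lifting property with respect to \<open>p\<close>.\<close>

definition has_lift :: "('o, 'a) cat \<Rightarrow> 'a \<Rightarrow> 'a \<Rightarrow> bool" where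
  "has_lift C i p \<longleftrightarrow>
     (\<forall>u\<in>hom C (src C i) (src C p). \<forall>v\<in>hom C (tgt C i) (tgt C p).
        cmp C p u = cmp C v i \<longrightarrow>
        (\<exists>h\<in>hom C (tgt C i) (src C p). cmp C h i = u \<and> cmp C p h = v))"

text \<open>The factorizations are not required to be functorial.\<close>

locale model_category = category C
  for \<kappa> :: "'k rel" and C :: "('o, 'a) cat" (structure)
    and W Cof Fib :: "'a set" +
  assumes locally_small: "locally_small \<kappa> C"
    and complete: "complete \<kappa> C"
    and cocomplete: "cocomplete \<kappa> C"
    and classes: "W \<subseteq> Mor C" "Cof \<subseteq> Mor C" "Fib \<subseteq> Mor C"
    and two_of_three: "f \<in> hom C X Y \<Longrightarrow> g \<in> hom C Y Z \<Longrightarrow>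
      (f \<in> W \<and> g \<in> W \<longrightarrow> g \<cdot> f \<in> W) \<and>
      (f \<in> W \<and> g \<cdot> f \<in> W \<longrightarrow> g \<in> W) \<and>
      (g \<in> W \<and> g \<cdot> f \<in> W \<longrightarrow> f \<in> W)"
    and retracts: "retract_map C f g \<Longrightarrow>
      (g \<in> W \<longrightarrow> f \<in> W) \<and> (g \<in> Cof \<longrightarrow> f \<in> Cof) \<and> (g \<in> Fib \<longrightarrow> f \<in> Fib)"
    and lifting_acyclic_fibration: "i \<in> Cof \<Longrightarrow> p \<in> W \<inter> Fib \<Longrightarrow> has_lift C i p"
    and lifting_acyclic_cofibration: "i \<in> W \<inter> Cof \<Longrightarrow> p \<in> Fib \<Longrightarrow> has_lift C i p"
    and factorization_acyclic_fibration:
      "f \<in> hom C X Y \<Longrightarrow> \<exists>V. \<exists>i\<in>hom C X V. \<exists>p\<in>hom C V Y. i \<in> Cof \<and> p \<in> W \<inter> Fib \<and> f = p \<cdot> i"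
    and factorization_acyclic_cofibration:
      "f \<in> hom C X Y \<Longrightarrow> \<exists>V. \<exists>i\<in>hom C X V. \<exists>p\<in>hom C V Y. i \<in> W \<inter> Cof \<and> p \<in> Fib \<and> f = p \<cdot> i"

definition cofibrant :: "('o, 'a) cat \<Rightarrow> 'a set \<Rightarrow> 'o \<Rightarrow> bool" where
  "cofibrant C Cof Y \<longleftrightarrow> (\<exists>Z. initial C Z \<and> (\<exists>f\<in>hom C Z Y. f \<in> Cof))"


section \<open>Generating cofibrations\<close>

text \<open>A partial order as a category; the arrow \<open>b \<rightarrow> c\<close> is the pair \<open>(b, c)\<close>.\<close>

definition order_cat :: "'k rel \<Rightarrow> ('k, 'k \<times> 'k) cat" where
  "order_cat r = \<lparr>Ob = Field r, Mor = r, src = fst, tgt = snd, ide = (\<lambda>b. (b, b)),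
     cmp = (\<lambda>g f. (fst f, snd g))\<rparr>"

definition is_succ :: "'k rel \<Rightarrow> 'k \<Rightarrow> 'k \<Rightarrow> bool" where
  "is_succ r b c \<longleftrightarrow> b \<in> underS r c \<and> (\<forall>d\<in>underS r c. (d, b) \<in> r)"

definition is_limit_elem :: "'k rel \<Rightarrow> 'k \<Rightarrow> bool" where
  "is_limit_elem r c \<longleftrightarrow> c \<in> Field r \<and> underS r c \<noteq> {} \<and> (\<nexists>b. is_succ r b c)"

text \<open>
  For a well-order \<open>r\<close> of order type \<open>\<lambda>\<close>: a \<open>\<lambda>\<close>-sequence is a functor \<open>\<lambda> \<rightarrow> C\<close> that is
  continuous at limit elements; it is a sequence in \<open>D\<close> if all its successor maps lie in \<open>D\<close>.
\<close>

definition sequence_in :: "('o, 'a) cat \<Rightarrow> 'a set \<Rightarrow> 'k rel \<Rightarrow> ('k \<Rightarrow> 'o) \<Rightarrow> ('k \<times> 'k \<Rightarrow> 'a) \<Rightarrow> bool" where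
  "sequence_in C D r Xo Xa \<longleftrightarrow> cat_functor (order_cat r) C Xo Xa \<and>
     (\<forall>c. is_limit_elem r c \<longrightarrow>
        is_colimit (order_cat (Restr r (underS r c))) C Xo Xa (Xo c) (\<lambda>b. Xa (b, c))) \<and>
     (\<forall>b c. is_succ r b c \<longrightarrow> Xa (b, c) \<in> D)"

text \<open>
  Relative \<open>I\<close>-cell complexes: transfinite compositions of pushouts of elements of \<open>I\<close>.
  Here \<open>r <o \<kappa>\<close> says that \<open>r\<close> is a well-order representing an ordinal less than \<open>\<kappa>\<close>.
\<close>

definition relative_cells :: "'k rel \<Rightarrow> ('o, 'a) cat \<Rightarrow> 'a set \<Rightarrow> 'a set" where
  "relative_cells \<kappa> C I = {\<iota> m | (r :: 'k rel) Xo Xa L \<iota> m.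
     r <o \<kappa> \<and> m \<in> Field r \<and> (\<forall>b\<in>Field r. (m, b) \<in> r) \<and>
     sequence_in C {f. \<exists>i\<in>I. pushout_of C i f} r Xo Xa \<and>
     is_colimit (order_cat r) C Xo Xa L \<iota>}"

text \<open>
  \<open>A\<close> is small relative to \<open>D\<close> if for some cardinal \<open>r0\<close> and all regular cardinals \<open>r \<ge> r0\<close>,
  \<open>C(A, _)\<close> commutes with colimits of \<open>r\<close>-sequences in \<open>D\<close>.
\<close>

definition small_relative_to :: "'k rel \<Rightarrow> ('o, 'a) cat \<Rightarrow> 'a set \<Rightarrow> 'o \<Rightarrow> bool" where
  "small_relative_to \<kappa> C D A \<longleftrightarrow> A \<in> Ob C \<and>
     (\<exists>r0 :: 'k rel. Card_order r0 \<and> r0 <o \<kappa> \<and>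
       (\<forall>r :: 'k rel. Cinfinite r \<and> regularCard r \<and> r0 \<le>o r \<and> r <o \<kappa> \<longrightarrow>
         (\<forall>Xo Xa L \<iota>. sequence_in C D r Xo Xa \<and> is_colimit (order_cat r) C Xo Xa L \<iota> \<longrightarrow>
            hom_commutes_with C A (order_cat r) Xo Xa L \<iota>)))"

definition permits_small_object_argument :: "'k rel \<Rightarrow> ('o, 'a) cat \<Rightarrow> 'a set \<Rightarrow> bool" where
  "permits_small_object_argument \<kappa> C I \<longleftrightarrow>
     (\<forall>i\<in>I. small_relative_to \<kappa> C (relative_cells \<kappa> C I) (src C i))"

definition generating_cofibrations ::
  "'k rel \<Rightarrow> ('o, 'a) cat \<Rightarrow> 'a set \<Rightarrow> 'a set \<Rightarrow> 'a set \<Rightarrow> bool" where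
  "generating_cofibrations \<kappa> C W Fib I \<longleftrightarrow>
     I \<subseteq> Mor C \<and> |I| <o \<kappa> \<and> permits_small_object_argument \<kappa> C I \<and>
     W \<inter> Fib = {p \<in> Mor C. \<forall>i\<in>I. has_lift C i p}"


section \<open>Finite CW objects\<close>

definition finite_CW :: "('o, 'a) cat \<Rightarrow> 'a set \<Rightarrow> 'o \<Rightarrow> bool" where
  "finite_CW C I Z \<longleftrightarrow>
     (\<exists>(n :: nat) Zo za. initial C (Zo 0) \<and> Zo n = Z \<and>
        (\<forall>k<n. za k \<in> hom C (Zo k) (Zo (Suc k)) \<and> (\<exists>i\<in>I. pushout_of C i (za k))))"

end

theory Submission
  imports Defs
begin

text \<open>
  For the first direction, factor \<open>* \<rightarrow> Y\<close> in the spirit of the small object argument, but through a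
  single filtered colimit of finite CW objects. A cell over \<open>Y\<close> records the finite complex it is
  attached to, its attaching map and its map to \<open>Y\<close>; the finite sets of cells closed under taking
  boundaries form a small directed poset, since the union of two such sets is again one. Each of them
  has a realization, characterized by a universal property and hence functorial in the set. Any lifting
  problem from a map in \<open>I\<close> to the colimit \<open>L \<rightarrow> Y\<close> is, by finiteness of the domain, one for a finite
  complex, and is solved by adjoining the cell that the problem itself describes. So \<open>L \<rightarrow> Y\<close> is an
  acyclic fibration, it has a section because \<open>Y\<close> is cofibrant, and the section factors through
  a finite complex because \<open>Y\<close> is finite.

  For the converse, finiteness and the lifting property of cofibrant objects are both inherited along
  the pushouts that build a finite CW object, and by retracts.
\<close>


section \<open>Small sets\<close>

text \<open>The usual small object argument iterates and then has to find a finite subcomplex inside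
  a transfinite composition. Here the iteration sits inside the datatype of cells: a boundary
  consists of cells with boundaries of their own, so the cell answering a lifting problem for a
  finite complex already belongs to the diagram, and one colimit suffices. Cells are data rather
  than isomorphism classes, so a union of complexes is a union of sets, even where maps between
  complexes are not monic. The price is that a cell refers to a specific object \<open>R S\<close>,
  which must be fixed beforehand; hence the global choice \<open>realization\<close>, whose
  existence is proved afterwards. The size convention shapes the rest. As \<kappa> is only an
  uncountable regular cardinal, smallness has to come from finite subsets and countable unions: a
  boundary is finite and a cell has finite size. As cocompleteness and finiteness are tested on
  index categories living on 'k, diagrams indexed by sets of cells have to be relabelled.\<close>

lemma size_cardinal_Cinfinite:
  assumes "size_cardinal \<kappa>"
  shows "Cinfinite \<kappa>"
proof -
  have "cinfinite \<kappa>"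
    by (rule cinfinite_mono[OF ordLess_imp_ordLeq natLeq_cinfinite])
      (use assms in \<open>simp add: size_cardinal_def\<close>)
  then show ?thesis
    using assms by (simp add: size_cardinal_def)
qed

text \<open>Regularity of \<kappa> enters here, in the form of stability under small unions.\<close>

lemma small_UN:
  assumes "size_cardinal \<kappa>" "|A| <o \<kappa>" "\<And>x. x \<in> A \<Longrightarrow> |f x| <o \<kappa>"
  shows "|\<Union>x\<in>A. f x| <o \<kappa>"
proof -
  have "stable \<kappa>"
    using size_cardinal_Cinfinite[OF assms(1)] assms(1)
    by (intro regularCard_stable) (auto simp: size_cardinal_def cinfinite_def)
  then show ?thesis
    by (rule stable_UNION) (use assms in auto)
qed

lemma small_subset: "A \<subseteq> B \<Longrightarrow> |B| <o \<kappa> \<Longrightarrow> |A| <o \<kappa>"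
  using card_of_mono1 ordLeq_ordLess_trans by blast

lemma small_image: "|A| <o \<kappa> \<Longrightarrow> |f ` A| <o \<kappa>"
  using card_of_image ordLeq_ordLess_trans by blast

text \<open>Uncountability of \<kappa> enters here; it makes countable unions of small sets
  small.\<close>

lemma small_nat: "size_cardinal \<kappa> \<Longrightarrow> |A :: nat set| <o \<kappa>"
  unfolding size_cardinal_def
  by (meson card_of_nat small_subset ordIso_ordLess_trans subset_UNIV)

lemma small_finite:
  assumes "size_cardinal \<kappa>" "finite A"
  shows "|A| <o \<kappa>"
  using assms finite_iff_ordLess_natLeq ordLess_transitive unfolding size_cardinal_def by blast

text \<open>Every finite subset is enumerated by a list, and the lists of a fixed length are counted
  by induction on that length. This avoids power sets, which may fail to be small.\<close>

lemma small_Fpow: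
  assumes \<kappa>: "size_cardinal \<kappa>" and A: "|A| <o \<kappa>"
  shows "|{S. S \<subseteq> A \<and> finite S}| <o \<kappa>"
proof -
  have len: "|{xs. set xs \<subseteq> A \<and> length xs = n}| <o \<kappa>" for n
  proof (induction n)
    case 0
    have "{xs. set xs \<subseteq> A \<and> length xs = 0} = {[]}" by auto
    then show ?case by (simp only:) (rule small_finite[OF \<kappa>], simp)
  next
    case (Suc n)
    have "{xs. set xs \<subseteq> A \<and> length xs = Suc n} \<subseteq>
        (\<Union>x\<in>A. (\<lambda>xs. x # xs) ` {xs. set xs \<subseteq> A \<and> length xs = n})"
      by (auto simp: length_Suc_conv)
    then show ?case
      by (rule small_subset) (rule small_UN[OF \<kappa> A], rule small_image, rule Suc.IH)
  qed
  have "{S. S \<subseteq> A \<and> finite S} \<subseteq> (\<Union>n. set ` {xs. set xs \<subseteq> A \<and> length xs = n})"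
  proof clarify
    fix S assume "S \<subseteq> A" "finite S"
    moreover then obtain xs where "set xs = S" using finite_list by blast
    ultimately show "S \<in> (\<Union>n. set ` {xs. set xs \<subseteq> A \<and> length xs = n})"
      by (intro UN_I[of "length xs"] image_eqI[of _ _ xs]) auto
  qed
  then show ?thesis
    by (rule small_subset)
      (rule small_UN[OF \<kappa> small_nat[OF \<kappa>]], rule small_image, rule len)
qed

text \<open>The field of \<kappa> consists of elements of 'k, so 'k has room for labels of any small
  set.\<close>

lemma small_inj:
  fixes \<kappa> :: "'k rel"
  assumes \<kappa>: "size_cardinal \<kappa>" and A: "|A| <o \<kappa>"
  obtains p :: "'a \<Rightarrow> 'k" where "inj_on p A"
proof -
  have "|A| \<le>o |Field \<kappa>|"
    using \<kappa> A unfolding size_cardinal_def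
    by (meson card_of_Field_ordIso ordIso_symmetric ordLess_imp_ordLeq ordLeq_ordIso_trans)
  then show ?thesis
    using that by (meson card_of_ordLeq)
qed


section \<open>Colimits over arbitrary small index categories\<close>

context category
begin

lemma hom_src: "f \<in> hom C X Y \<Longrightarrow> X \<in> Ob C"
  using src_in_Ob by (auto simp: hom_def)

lemma hom_tgt: "f \<in> hom C X Y \<Longrightarrow> Y \<in> Ob C"
  using tgt_in_Ob by (auto simp: hom_def)

lemma hom_self: "f \<in> Mor C \<Longrightarrow> f \<in> hom C (src C f) (tgt C f)"
  by (simp add: hom_def)

end

lemma (in category) category_self: "category C" by unfold_locales

lemma cat_functor_hom:
  "cat_functor J C Fo Fa \<Longrightarrow> category J \<Longrightarrow> u \<in> hom J i j \<Longrightarrow> Fa u \<in> hom C (Fo i) (Fo j)"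
  unfolding cat_functor_def using category.hom_src category.hom_tgt by metis

lemma cat_functor_cmp:
  "cat_functor J C Fo Fa \<Longrightarrow> category J \<Longrightarrow> u \<in> hom J i j \<Longrightarrow> v \<in> hom J j k
    \<Longrightarrow> Fa (cmp J v u) = cmp C (Fa v) (Fa u)"
  unfolding cat_functor_def using category.hom_src category.hom_tgt by metis

lemma cat_functor_Ob: "cat_functor J C Fo Fa \<Longrightarrow> j \<in> Ob J \<Longrightarrow> Fo j \<in> Ob C"
  unfolding cat_functor_def by blast

lemma cocone_hom: "cocone J C Fo Fa L \<iota> \<Longrightarrow> j \<in> Ob J \<Longrightarrow> \<iota> j \<in> hom C (Fo j) L"
  unfolding cocone_def by blast

lemma cocone_cmp:
  "cocone J C Fo Fa L \<iota> \<Longrightarrow> category J \<Longrightarrow> u \<in> hom J i j \<Longrightarrow> cmp C (\<iota> j) (Fa u) = \<iota> i"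
  unfolding cocone_def using category.hom_src category.hom_tgt by metis

lemma is_colimit_cocone: "is_colimit J C Fo Fa L \<iota> \<Longrightarrow> cocone J C Fo Fa L \<iota>"
  unfolding is_colimit_def by blast

text \<open>Transport of structure along labellings of objects and arrows. It carries cocompleteness
  and finiteness, both stated for index categories on 'k, to spans indexed by numbers and to the
  poset of complexes.\<close>

definition relabel :: "('j \<Rightarrow> 'k) \<Rightarrow> ('b \<Rightarrow> 'l) \<Rightarrow> ('j, 'b) cat \<Rightarrow> ('k, 'l) cat" where
  "relabel p q J = \<lparr>Ob = p ` Ob J, Mor = q ` Mor J,
     src = (\<lambda>b. p (src J (the_inv_into (Mor J) q b))),
     tgt = (\<lambda>b. p (tgt J (the_inv_into (Mor J) q b))),
     ide = (\<lambda>x. q (ide J (the_inv_into (Ob J) p x))),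
     cmp = (\<lambda>b a. q (cmp J (the_inv_into (Mor J) q b) (the_inv_into (Mor J) q a)))\<rparr>"

locale relabelling = J: category J for J :: "('j, 'b) cat" +
  fixes p :: "'j \<Rightarrow> 'k" and q :: "'b \<Rightarrow> 'l"
  assumes p: "inj_on p (Ob J)" and q: "inj_on q (Mor J)"
begin

abbreviation "p' \<equiv> the_inv_into (Ob J) p"
abbreviation "q' \<equiv> the_inv_into (Mor J) q"
abbreviation "J' \<equiv> relabel p q J"

lemma p'p: "x \<in> Ob J \<Longrightarrow> p' (p x) = x"
  by (rule the_inv_into_f_f[OF p])

lemma q'q: "u \<in> Mor J \<Longrightarrow> q' (q u) = u"
  by (rule the_inv_into_f_f[OF q])

lemma q'q_hom: "u \<in> hom J i j \<Longrightarrow> q' (q u) = u"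
  by (simp add: hom_def q'q)

lemma Ob': "Ob J' = p ` Ob J"
  by (simp add: relabel_def)

lemma hom': "i \<in> Ob J \<Longrightarrow> j \<in> Ob J \<Longrightarrow> hom J' (p i) (p j) = q ` hom J i j"
  using J.src_in_Ob J.tgt_in_Ob
  by (auto simp: hom_def relabel_def q'q image_iff inj_on_eq_iff[OF p])

lemma cmp': "u \<in> hom J i j \<Longrightarrow> v \<in> hom J j k \<Longrightarrow> cmp J' (q v) (q u) = q (cmp J v u)"
  by (simp add: relabel_def q'q_hom)

lemma ide': "i \<in> Ob J \<Longrightarrow> ide J' (p i) = q (ide J i)"
  by (simp add: relabel_def p'p)

lemma hom'E:
  assumes "f \<in> hom J' x y"
  obtains i j u where "i \<in> Ob J" "j \<in> Ob J" "x = p i" "y = p j" "u \<in> hom J i j" "f = q u"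
  using assms J.src_in_Ob J.tgt_in_Ob
  by (auto simp: hom_def relabel_def q'q)

lemma category_relabel: "category J'"
proof
  fix f assume "f \<in> Mor J'"
  then show "src J' f \<in> Ob J'" "tgt J' f \<in> Ob J'"
    using J.src_in_Ob J.tgt_in_Ob by (auto simp: relabel_def q'q)
next
  fix X assume "X \<in> Ob J'"
  then show "ide J' X \<in> hom J' X X"
    using J.ide_in_hom by (auto simp: Ob' hom' ide')
next
  fix f X Y g Z
  assume f: "f \<in> hom J' X Y" and g: "g \<in> hom J' Y Z"
  obtain i j u where u: "i \<in> Ob J" "j \<in> Ob J" "X = p i" "Y = p j" "u \<in> hom J i j" "f = q u"
    using f by (rule hom'E)
  obtain j2 k v where v: "j2 \<in> Ob J" "k \<in> Ob J" "Y = p j2" "Z = p k" "v \<in> hom J j2 k" "g = q v"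
    using g by (rule hom'E)
  have [simp]: "j2 = j" using u v p by (metis inj_onD)
  show "cmp J' g f \<in> hom J' X Z"
    using u v J.cmp_in_hom[of u i j v k] by (auto simp: cmp'[of u i j v k] hom')
next
  fix f X Y assume "f \<in> hom J' X Y"
  then obtain i j u where u: "i \<in> Ob J" "j \<in> Ob J" "X = p i" "Y = p j" "u \<in> hom J i j" "f = q u"
    by (rule hom'E)
  show "cmp J' f (ide J' X) = f" "cmp J' (ide J' Y) f = f"
    using u J.cmp_ide J.ide_cmp J.ide_in_hom
    by (simp_all add: ide' cmp'[of "ide J i" i i u j] cmp'[of u i j "ide J j" j])
next
  fix f X Y g Z h V
  assume f: "f \<in> hom J' X Y" and g: "g \<in> hom J' Y Z" and h: "h \<in> hom J' Z V"
  obtain i j u where u: "i \<in> Ob J" "j \<in> Ob J" "X = p i" "Y = p j" "u \<in> hom J i j" "f = q u"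
    using f by (rule hom'E)
  obtain j2 k v where v: "j2 \<in> Ob J" "k \<in> Ob J" "Y = p j2" "Z = p k" "v \<in> hom J j2 k" "g = q v"
    using g by (rule hom'E)
  obtain k2 l w where w: "k2 \<in> Ob J" "l \<in> Ob J" "Z = p k2" "V = p l" "w \<in> hom J k2 l" "h = q w"
    using h by (rule hom'E)
  have [simp]: "j2 = j" "k2 = k" using u v w p by (metis inj_onD)+
  have uvw: "u \<in> hom J i j" "v \<in> hom J j k" "w \<in> hom J k l" using u v w by auto
  show "cmp J' (cmp J' h g) f = cmp J' h (cmp J' g f)"
    using J.cmp_assoc[OF uvw] J.cmp_in_hom[OF uvw(1,2)] J.cmp_in_hom[OF uvw(2,3)] uvw u v w
    by (simp add: cmp'[of v j k w l] cmp'[of u i j v k] cmp'[of u i j "cmp J w v" l]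
        cmp'[of "cmp J v u" i k w l])
qed

lemma functor_relabel:
  assumes F: "cat_functor J C Fo Fa"
  shows "cat_functor J' C (Fo \<circ> p') (Fa \<circ> q')"
  unfolding cat_functor_def Ob'
proof (intro conjI ballI; (elim imageE)?; clarsimp simp: hom')
  fix j assume j: "j \<in> Ob J"
  then show "Fo (p' (p j)) \<in> Ob C" "Fa (q' (ide J' (p j))) = ide C (Fo (p' (p j)))"
    using F q'q_hom[OF J.ide_in_hom[OF j]] by (simp_all add: cat_functor_def ide' p'p)
next
  fix i j u assume "i \<in> Ob J" "j \<in> Ob J" "u \<in> hom J i j"
  then show "Fa (q' (q u)) \<in> hom C (Fo (p' (p i))) (Fo (p' (p j)))"
    by (simp add: p'p q'q_hom cat_functor_hom[OF F J.category_self])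
next
  fix i j k u v assume uv: "u \<in> hom J i j" "v \<in> hom J j k"
  then show "Fa (q' (cmp J' (q v) (q u))) = cmp C (Fa (q' (q v))) (Fa (q' (q u)))"
    using q'q_hom[OF J.cmp_in_hom[OF uv]] cat_functor_cmp[OF F J.category_self uv]
    by (simp add: cmp' q'q_hom)
qed

lemma cocone_relabel:
  assumes "\<And>j. j \<in> Ob J \<Longrightarrow> \<iota>' (p j) = \<iota> j"
  shows "cocone J' C (Fo \<circ> p') (Fa \<circ> q') L \<iota>' \<longleftrightarrow> cocone J C Fo Fa L \<iota>"
  unfolding cocone_def Ob' using assms
  by (auto simp: hom' p'p q'q_hom)

text \<open>Composition with \<open>p\<close> and \<open>p'\<close> matches the cocones of the two
  diagrams. The legs are only compared on labels, so the lemma serves in both directions: with legs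
  \<open>\<iota>\<close> and \<open>\<iota> \<circ> p\<close>, or \<open>\<iota> \<circ> p'\<close>
  and \<open>\<iota>\<close>.\<close>

lemma is_colimit_relabel:
  assumes \<iota>: "\<And>j. j \<in> Ob J \<Longrightarrow> \<iota>' (p j) = \<iota> j"
  shows "is_colimit J' C (Fo \<circ> p') (Fa \<circ> q') L \<iota>' \<longleftrightarrow> is_colimit J C Fo Fa L \<iota>"
proof -
  have "(\<forall>L' \<mu>. cocone J' C (Fo \<circ> p') (Fa \<circ> q') L' \<mu> \<longrightarrow>
          (\<exists>!h. h \<in> hom C L L' \<and> (\<forall>j\<in>Ob J'. cmp C h (\<iota>' j) = \<mu> j))) \<longleftrightarrow>
        (\<forall>L' \<mu>. cocone J C Fo Fa L' \<mu> \<longrightarrow>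
          (\<exists>!h. h \<in> hom C L L' \<and> (\<forall>j\<in>Ob J. cmp C h (\<iota> j) = \<mu> j)))" (is "?l \<longleftrightarrow> ?r")
  proof
    assume l: ?l
    show ?r
    proof (intro allI impI)
      fix L' \<mu> assume "cocone J C Fo Fa L' \<mu>"
      then have "cocone J' C (Fo \<circ> p') (Fa \<circ> q') L' (\<mu> \<circ> p')"
        by (subst cocone_relabel) (auto simp: p'p)
      with l have "\<exists>!h. h \<in> hom C L L' \<and> (\<forall>j\<in>Ob J'. cmp C h (\<iota>' j) = (\<mu> \<circ> p') j)" by blast
      then show "\<exists>!h. h \<in> hom C L L' \<and> (\<forall>j\<in>Ob J. cmp C h (\<iota> j) = \<mu> j)"
        by (simp add: Ob' p'p \<iota>)
    qed
  next
    assume r: ?r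
    show ?l
    proof (intro allI impI)
      fix L' \<mu> assume "cocone J' C (Fo \<circ> p') (Fa \<circ> q') L' \<mu>"
      then have "cocone J C Fo Fa L' (\<mu> \<circ> p)"
        by (subst (asm) cocone_relabel) auto
      with r have "\<exists>!h. h \<in> hom C L L' \<and> (\<forall>j\<in>Ob J. cmp C h (\<iota> j) = (\<mu> \<circ> p) j)" by blast
      then show "\<exists>!h. h \<in> hom C L L' \<and> (\<forall>j\<in>Ob J'. cmp C h (\<iota>' j) = \<mu> j)"
        by (simp add: Ob' \<iota>)
    qed
  qed
  then show ?thesis
    by (simp only: is_colimit_def cocone_relabel[of \<iota>' \<iota>, OF \<iota>])
qed

lemma filtered_relabel:
  assumes "filtered J"
  shows "filtered J'"
  unfolding filtered_def
proof (intro conjI)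
  show "Ob J' \<noteq> {}" using assms by (simp add: filtered_def Ob')
  show "\<forall>i\<in>Ob J'. \<forall>j\<in>Ob J'. \<exists>k\<in>Ob J'. hom J' i k \<noteq> {} \<and> hom J' j k \<noteq> {}"
  proof (intro ballI)
    fix x y assume "x \<in> Ob J'" "y \<in> Ob J'"
    then obtain i j where ij: "i \<in> Ob J" "j \<in> Ob J" "x = p i" "y = p j"
      by (auto simp: Ob')
    then obtain k where k: "k \<in> Ob J" "hom J i k \<noteq> {}" "hom J j k \<noteq> {}"
      using assms unfolding filtered_def by blast
    show "\<exists>k\<in>Ob J'. hom J' x k \<noteq> {} \<and> hom J' y k \<noteq> {}"
    proof (rule bexI)
      show "hom J' x (p k) \<noteq> {} \<and> hom J' y (p k) \<noteq> {}"
        using ij k by (simp add: hom')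
      show "p k \<in> Ob J'" using k by (simp add: Ob')
    qed
  qed
  show "\<forall>i\<in>Ob J'. \<forall>j\<in>Ob J'. \<forall>u\<in>hom J' i j. \<forall>v\<in>hom J' i j.
        \<exists>k\<in>Ob J'. \<exists>w\<in>hom J' j k. cmp J' w u = cmp J' w v"
  proof (intro ballI)
    fix x y f g assume "x \<in> Ob J'" "y \<in> Ob J'" and fg: "f \<in> hom J' x y" "g \<in> hom J' x y"
    then obtain i j where ij: "i \<in> Ob J" "j \<in> Ob J" "x = p i" "y = p j"
      by (auto simp: Ob')
    then obtain u v where uv: "u \<in> hom J i j" "v \<in> hom J i j" "f = q u" "g = q v"
      using fg by (auto simp: hom')
    obtain k w where k: "k \<in> Ob J" "w \<in> hom J j k" "cmp J w u = cmp J w v"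
      using assms ij uv unfolding filtered_def by blast
    show "\<exists>k\<in>Ob J'. \<exists>w\<in>hom J' y k. cmp J' w f = cmp J' w g"
    proof (intro bexI)
      show "cmp J' (q w) f = cmp J' (q w) g"
        using uv k cmp'[OF uv(1) k(2)] cmp'[OF uv(2) k(2)] by simp
      show "q w \<in> hom J' y (p k)" using ij k by (simp add: hom')
      show "p k \<in> Ob J'" using k by (simp add: Ob')
    qed
  qed
qed

lemma small_relabel: "small_category \<kappa> J \<Longrightarrow> small_category \<kappa> J'"
  using category_relabel by (simp add: small_category_def relabel_def small_image)

end

lemma small_category_relabelling:
  fixes \<kappa> :: "'k rel"
    and J :: "('j, 'b) cat"
  assumes "size_cardinal \<kappa>" "small_category \<kappa> J"
  obtains p :: "'j \<Rightarrow> 'k" and q :: "'b \<Rightarrow> 'k" where "relabelling J p q"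
proof -
  obtain p :: "'j \<Rightarrow> 'k" where "inj_on p (Ob J)"
    using assms by (metis small_category_def small_inj)
  moreover obtain q :: "'b \<Rightarrow> 'k" where "inj_on q (Mor J)"
    using assms by (metis small_category_def small_inj)
  ultimately show ?thesis
    using assms(2) that by (simp add: relabelling_def relabelling_axioms_def small_category_def)
qed

lemma cocomplete_colimit:
  fixes \<kappa> :: "'k rel" and J :: "('j, 'b) cat"
  assumes "size_cardinal \<kappa>" "cocomplete \<kappa> C" "small_category \<kappa> J" "cat_functor J C Fo Fa"
  obtains L \<iota> where "is_colimit J C Fo Fa L \<iota>"
proof -
  obtain p :: "'j \<Rightarrow> 'k" and q :: "'b \<Rightarrow> 'k" where "relabelling J p q"
    using small_category_relabelling[OF assms(1,3)] by blast
  then interpret relabelling J p q .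
  obtain L \<iota> where "is_colimit J' C (Fo \<circ> p') (Fa \<circ> q') L \<iota>"
    using assms functor_relabel small_relabel unfolding cocomplete_def by blast
  then have "is_colimit J C Fo Fa L (\<iota> \<circ> p)"
    by (subst (asm) is_colimit_relabel) auto
  then show ?thesis by (rule that)
qed

section \<open>Posets as index categories\<close>

lemma category_order_cat: "Refl r \<Longrightarrow> trans r \<Longrightarrow> category (order_cat r)"
  by unfold_locales
    (auto simp: order_cat_def hom_def refl_on_def FieldI1 FieldI2 intro: transD)

lemma hom_order_cat: "hom (order_cat r) b c = (if (b, c) \<in> r then {(b, c)} else {})"
  by (auto simp: hom_def order_cat_def)

lemma order_cat_simps [simp]:
  "Ob (order_cat r) = Field r" "Mor (order_cat r) = r" "ide (order_cat r) b = (b, b)"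
  "cmp (order_cat r) (b, c) (a, b') = (a, c)"
  by (simp_all add: order_cat_def)

lemma filtered_order_cat:
  assumes "Refl r" "Field r \<noteq> {}"
    and dir: "\<And>b c. b \<in> Field r \<Longrightarrow> c \<in> Field r \<Longrightarrow> \<exists>d. (b, d) \<in> r \<and> (c, d) \<in> r"
  shows "filtered (order_cat r)"
  unfolding filtered_def order_cat_simps
proof (intro conjI ballI)
  show "Field r \<noteq> {}" by fact
next
  fix b c assume "b \<in> Field r" "c \<in> Field r"
  then obtain d where "(b, d) \<in> r" "(c, d) \<in> r" using dir by blast
  then show "\<exists>d\<in>Field r. hom (order_cat r) b d \<noteq> {} \<and> hom (order_cat r) c d \<noteq> {}"
    by (intro bexI[of _ d]) (auto simp: hom_order_cat FieldI2)
next
  fix b c u v assume "c \<in> Field r" "u \<in> hom (order_cat r) b c" "v \<in> hom (order_cat r) b c"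
  moreover from this have "(c, c) \<in> r" using \<open>Refl r\<close> by (simp add: refl_on_def)
  ultimately show "\<exists>d\<in>Field r. \<exists>w\<in>hom (order_cat r) c d. cmp (order_cat r) w u = cmp (order_cat r) w v"
    by (intro bexI[of _ c] bexI[of _ "(c, c)"]) (auto simp: hom_order_cat split: if_splits)
qed

lemma cat_functor_order_cat:
  assumes "\<And>b. b \<in> Field r \<Longrightarrow> Fo b \<in> Ob C \<and> Fa (b, b) = ide C (Fo b)"
    and "\<And>b c. (b, c) \<in> r \<Longrightarrow> Fa (b, c) \<in> hom C (Fo b) (Fo c)"
    and "\<And>b c d. (b, c) \<in> r \<Longrightarrow> (c, d) \<in> r \<Longrightarrow> Fa (b, d) = cmp C (Fa (c, d)) (Fa (b, c))"
  shows "cat_functor (order_cat r) C Fo Fa"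
  using assms by (simp add: cat_functor_def hom_order_cat)

lemma cocone_order_cat:
  "cocone (order_cat r) C Fo Fa L \<iota> \<longleftrightarrow> L \<in> Ob C \<and> (\<forall>b\<in>Field r. \<iota> b \<in> hom C (Fo b) L) \<and>
    (\<forall>(b, c)\<in>r. cmp C (\<iota> c) (Fa (b, c)) = \<iota> b)"
  by (auto simp: cocone_def hom_order_cat FieldI1 FieldI2)

section \<open>Initial objects and pushouts as colimits of finite diagrams\<close>

context category
begin

lemma initial_exists:
  assumes "size_cardinal \<kappa>" "cocomplete \<kappa> C"
  obtains Z where "initial C Z"
proof -
  \<comment> \<open>Over the empty poset every condition on a functor is vacuous, so its values may
    be \<open>undefined\<close>, and a cocone is just an object.\<close>
  let ?J = "order_cat ({} :: nat rel)"
  have "small_category \<kappa> ?J"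
    unfolding small_category_def order_cat_simps
    by (intro conjI category_order_cat small_finite[OF assms(1)]) (auto simp: refl_on_def trans_def)
  moreover have "cat_functor ?J C undefined undefined"
    by (rule cat_functor_order_cat) auto
  ultimately obtain L \<iota> where "is_colimit ?J C undefined undefined L \<iota>"
    using cocomplete_colimit[OF assms] by blast
  then have "initial C L"
    by (auto simp: is_colimit_def cocone_order_cat initial_def)
  then show ?thesis by (rule that)
qed

lemma pushout_exists:
  assumes "size_cardinal \<kappa>" "cocomplete \<kappa> C" and i: "i \<in> hom C A B" and g: "g \<in> hom C A X"
  obtains f h X' where "is_pushout C i f g h" "f \<in> hom C X X'" "h \<in> hom C B X'"
proof -
  \<comment> \<open>The span \<open>B <- A -> X\<close> as a functor on the poset in which 0 lies
    below 1 and 2: the arrow (0, 1) goes to \<open>i\<close>, and (0, 2) goes to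
    \<open>g\<close>.\<close>
  define r :: "nat rel" where "r = {(0, 0), (1, 1), (2, 2), (0, 1), (0, 2)}"
  define Fo where "Fo n = (if n = 0 then A else if n = 1 then B else X)" for n :: nat
  define Fa where "Fa = (\<lambda>(m, n). if m = n then ide C (Fo m) else if n = 1 then i else g)"
  have F: "Field r = {0, 1, 2}" by (auto simp: r_def Field_def)
  have ob: "A \<in> Ob C" "B \<in> Ob C" "X \<in> Ob C" using hom_src hom_tgt i g by blast+
  have ids: "i \<cdot> ide C A = i" "ide C B \<cdot> i = i" "g \<cdot> ide C A = g" "ide C X \<cdot> g = g"
    "ide C A \<cdot> ide C A = ide C A" "ide C B \<cdot> ide C B = ide C B" "ide C X \<cdot> ide C X = ide C X"
    using i g ob by (simp_all add: cmp_ide[OF i] ide_cmp[OF i] cmp_ide[OF g] ide_cmp[OF g]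
        cmp_ide[OF ide_in_hom])
  have "small_category \<kappa> (order_cat r)"
    unfolding small_category_def order_cat_simps
  proof (intro conjI small_finite[OF assms(1)])
    show "category (order_cat r)"
      by (rule category_order_cat) (auto simp: refl_on_def F trans_def, auto simp: r_def)
    show "finite (Field r)" "finite r" by (simp add: F) (simp add: r_def)
  qed
  moreover have "cat_functor (order_cat r) C Fo Fa"
  proof (rule cat_functor_order_cat)
    show "Fo b \<in> Ob C \<and> Fa (b, b) = ide C (Fo b)" for b
      using ob by (simp add: Fo_def Fa_def)
    show "Fa (b, c) \<in> hom C (Fo b) (Fo c)" if "(b, c) \<in> r" for b c
      using that i g ob(1)[THEN ide_in_hom] ob(2)[THEN ide_in_hom] ob(3)[THEN ide_in_hom]
      by (auto simp: Fo_def Fa_def r_def)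
    show "Fa (b, d) = Fa (c, d) \<cdot> Fa (b, c)" if "(b, c) \<in> r" "(c, d) \<in> r" for b c d
      using that ids by (auto simp: Fo_def Fa_def r_def)
  qed
  ultimately obtain X' \<iota> where colim: "is_colimit (order_cat r) C Fo Fa X' \<iota>"
    using cocomplete_colimit[OF assms(1,2)] by blast
  have cocone: "cocone (order_cat r) C Fo Fa T \<mu> \<longleftrightarrow> \<mu> 0 \<in> hom C A T \<and> \<mu> 1 \<in> hom C B T \<and>
      \<mu> 2 \<in> hom C X T \<and> \<mu> 1 \<cdot> i = \<mu> 0 \<and> \<mu> 2 \<cdot> g = \<mu> 0" for T \<mu>
    unfolding cocone_order_cat F
    using cmp_ide[of "\<mu> 0" A T] cmp_ide[of "\<mu> 1" B T] cmp_ide[of "\<mu> 2" X T] hom_tgt[of "\<mu> 0" A T]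
    by (auto simp: r_def Fo_def Fa_def)
  have \<iota>: "\<iota> 1 \<in> hom C B X'" "\<iota> 2 \<in> hom C X X'" "\<iota> 2 \<cdot> g = \<iota> 1 \<cdot> i"
    using is_colimit_cocone[OF colim] unfolding cocone by auto
  have "is_pushout C i (\<iota> 2) g (\<iota> 1)"
    unfolding is_pushout_def
  proof (intro conjI allI ballI impI)
    show "i \<in> Mor C" "\<iota> 2 \<in> Mor C" "g \<in> hom C (src C i) (src C (\<iota> 2))"
      "\<iota> 1 \<in> hom C (tgt C i) (tgt C (\<iota> 2))" "\<iota> 2 \<cdot> g = \<iota> 1 \<cdot> i"
      using i g \<iota> by (auto simp: hom_def)
  next
    fix T p q assume "p \<in> hom C (src C (\<iota> 2)) T" "q \<in> hom C (tgt C i) T" and pq: "p \<cdot> g = q \<cdot> i"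
    then have p: "p \<in> hom C X T" and q: "q \<in> hom C B T" using i \<iota> by (auto simp: hom_def)
    define \<mu> where "\<mu> = (\<lambda>n :: nat. if n = 0 then p \<cdot> g else if n = 1 then q else p)"
    have "cocone (order_cat r) C Fo Fa T \<mu>"
      unfolding cocone using p q pq cmp_in_hom[OF g p] by (simp add: \<mu>_def)
    then have ex1: "\<exists>!t. t \<in> hom C X' T \<and> (\<forall>n\<in>{0, 1, 2}. t \<cdot> \<iota> n = \<mu> n)"
      using colim unfolding is_colimit_def order_cat_simps F by blast
    \<comment> \<open>The condition at 0 follows from the one at 2, so unique existence for the
      colimit and for the pushout concern the same \<open>t\<close>.\<close>
    have "t \<cdot> \<iota> 0 = p \<cdot> g" if "t \<in> hom C X' T" "t \<cdot> \<iota> 2 = p" for t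
      using cmp_assoc[OF g \<iota>(2) that(1)] is_colimit_cocone[OF colim] that(2) unfolding cocone by simp
    then have "t \<in> hom C X' T \<and> (\<forall>n\<in>{0, 1, 2}. t \<cdot> \<iota> n = \<mu> n) \<longleftrightarrow>
        t \<in> hom C (tgt C (\<iota> 2)) T \<and> t \<cdot> \<iota> 2 = p \<and> t \<cdot> \<iota> 1 = q" for t
      using \<iota>(2) by (auto simp: \<mu>_def hom_def)
    then show "\<exists>!t. t \<in> hom C (tgt C (\<iota> 2)) T \<and> t \<cdot> \<iota> 2 = p \<and> t \<cdot> \<iota> 1 = q"
      using ex1 by simp
  qed
  then show ?thesis using that \<iota> by blast
qed

end


section \<open>Maps into filtered colimits\<close>

text \<open>A cocone is enough to define the canonical map and to express its bijectivity by
  elements. The universal property of \<open>L\<close> only enters when finiteness of an object is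
  applied.\<close>

locale filtered_cocone = category C + J: category J
  for C :: "('o, 'a) cat" (structure) and J :: "('j, 'b) cat" +
  fixes Fo Fa L \<iota>
  assumes filt: "filtered J" and func: "cat_functor J C Fo Fa" and cone: "cocone J C Fo Fa L \<iota>"
begin

lemmas Fa_hom = cat_functor_hom[OF func J.category_self]
lemmas Fa_cmp = cat_functor_cmp[OF func J.category_self]
lemmas \<iota>_hom = cocone_hom[OF cone]
lemmas \<iota>_cmp = cocone_cmp[OF cone J.category_self]

lemma ub:
  assumes "i \<in> Ob J" "j \<in> Ob J"
  obtains k u v where "k \<in> Ob J" "u \<in> hom J i k" "v \<in> hom J j k"
  using assms filt unfolding filtered_def by blast

lemma coeq:
  assumes "u \<in> hom J i j" "v \<in> hom J i j"
  obtains k w where "k \<in> Ob J" "w \<in> hom J j k" "cmp J w u = cmp J w v"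
  using assms filt J.hom_src[OF assms(1)] J.hom_tgt[OF assms(1)] unfolding filtered_def by blast

lemma amalgamate:
  assumes u: "u \<in> hom J i j" and v: "v \<in> hom J i k"
  obtains l u' v' where "l \<in> Ob J" "u' \<in> hom J j l" "v' \<in> hom J k l" "cmp J u' u = cmp J v' v"
proof -
  obtain m a b where m: "m \<in> Ob J" "a \<in> hom J j m" "b \<in> hom J k m"
    using ub J.hom_tgt[OF u] J.hom_tgt[OF v] by blast
  obtain l w where l: "l \<in> Ob J" "w \<in> hom J m l" "cmp J w (cmp J a u) = cmp J w (cmp J b v)"
    using coeq[OF J.cmp_in_hom[OF u m(2)] J.cmp_in_hom[OF v m(3)]] .
  have "cmp J (cmp J w a) u = cmp J (cmp J w b) v"
    using l J.cmp_assoc[OF u m(2) l(2)] J.cmp_assoc[OF v m(3) l(2)] by simp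
  then show ?thesis
    using that l(1) J.cmp_in_hom[OF m(2) l(2)] J.cmp_in_hom[OF m(3) l(2)] by blast
qed

text \<open>First make \<open>u\<close> and \<open>u'\<close> agree, then coequalize the composites
  of \<open>v\<close> and \<open>v'\<close>; postcomposition preserves the first equality. This
  merges two comparisons made at different stages into one made by a single pair of arrows, as the
  injectivity argument for pushouts requires.\<close>

lemma amalgamate2:
  assumes u: "u \<in> hom J i k" "v \<in> hom J j k" and u': "u' \<in> hom J i k'" "v' \<in> hom J j k'"
  obtains l w w' where "l \<in> Ob J" "w \<in> hom J k l" "w' \<in> hom J k' l"
    "cmp J w u = cmp J w' u'" "cmp J w v = cmp J w' v'"
proof -
  obtain m a b where m: "m \<in> Ob J" "a \<in> hom J k m" "b \<in> hom J k' m" "cmp J a u = cmp J b u'"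
    using amalgamate[OF u(1) u'(1)] .
  obtain l c where l: "l \<in> Ob J" "c \<in> hom J m l" "cmp J c (cmp J a v) = cmp J c (cmp J b v')"
    using coeq[OF J.cmp_in_hom[OF u(2) m(2)] J.cmp_in_hom[OF u'(2) m(3)]] .
  have "cmp J (cmp J c a) u = cmp J (cmp J c b) u'" "cmp J (cmp J c a) v = cmp J (cmp J c b) v'"
    using l m(4) J.cmp_assoc[OF u(1) m(2) l(2)] J.cmp_assoc[OF u'(1) m(3) l(2)]
      J.cmp_assoc[OF u(2) m(2) l(2)] J.cmp_assoc[OF u'(2) m(3) l(2)] by simp_all
  then show ?thesis
    using that l(1) J.cmp_in_hom[OF m(2) l(2)] J.cmp_in_hom[OF m(3) l(2)] by blast
qed

text \<open>The closed form of the equivalence relation on a filtered colimit of sets: two elements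
  are identified when their images agree at some common later stage.\<close>

definition eventually_eq :: "'j \<times> 'a \<Rightarrow> 'j \<times> 'a \<Rightarrow> bool" where
  "eventually_eq x y \<longleftrightarrow> (\<exists>k\<in>Ob J. \<exists>u\<in>hom J (fst x) k. \<exists>v\<in>hom J (fst y) k. Fa u \<cdot> snd x = Fa v \<cdot> snd y)"

abbreviation "H Y \<equiv> hom_union C Y J Fo"
abbreviation "step Y \<equiv> hom_step C Y J Fo Fa"
abbreviation "gen Y \<equiv> Restr ((step Y \<union> (step Y)\<inverse>)\<^sup>*) (H Y)"

lemma Fa_cmp_assoc:
  assumes "u \<in> hom J i j" "v \<in> hom J j k" "f \<in> hom C Y (Fo i)"
  shows "Fa (cmp J v u) \<cdot> f = Fa v \<cdot> (Fa u \<cdot> f)"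
  using cmp_assoc[OF assms(3) Fa_hom[OF assms(1)] Fa_hom[OF assms(2)]]
  by (simp add: Fa_cmp[OF assms(1,2)])

lemma \<iota>_Fa:
  assumes "u \<in> hom J i j" "f \<in> hom C Y (Fo i)"
  shows "\<iota> j \<cdot> (Fa u \<cdot> f) = \<iota> i \<cdot> f"
  using cmp_assoc[OF assms(2) Fa_hom[OF assms(1)] \<iota>_hom[OF J.hom_tgt[OF assms(1)]]]
  by (simp add: \<iota>_cmp[OF assms(1)])

lemma eventually_eq_trans:
  assumes x: "x \<in> H Y" and y: "y \<in> H Y" and z: "z \<in> H Y"
    and xy: "eventually_eq x y" and yz: "eventually_eq y z"
  shows "eventually_eq x z"
proof -
  obtain i f j g k h where eqs: "x = (i, f)" "y = (j, g)" "z = (k, h)"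
    by (cases x; cases y; cases z)
  have f: "f \<in> hom C Y (Fo i)" and g: "g \<in> hom C Y (Fo j)" and h: "h \<in> hom C Y (Fo k)"
    using x y z by (auto simp: eqs hom_union_def)
  obtain a u v where a: "u \<in> hom J i a" "v \<in> hom J j a" "Fa u \<cdot> f = Fa v \<cdot> g"
    using xy by (auto simp: eventually_eq_def eqs)
  obtain b w t where b: "w \<in> hom J j b" "t \<in> hom J k b" "Fa w \<cdot> g = Fa t \<cdot> h"
    using yz by (auto simp: eventually_eq_def eqs)
  \<comment> \<open>The two comparisons leave the middle index \<open>j\<close> along different
    arrows; amalgamating these makes the comparisons meet.\<close>
  obtain l c d where l: "l \<in> Ob J" "c \<in> hom J a l" "d \<in> hom J b l" "cmp J c v = cmp J d w"
    using amalgamate[OF a(2) b(1)] .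
  have "Fa (cmp J c u) \<cdot> f = Fa (cmp J c v) \<cdot> g"
    using a by (simp add: Fa_cmp_assoc[OF a(1) l(2) f] Fa_cmp_assoc[OF a(2) l(2) g])
  also have "\<dots> = Fa (cmp J d t) \<cdot> h"
    using b by (simp add: l(4) Fa_cmp_assoc[OF b(1) l(3) g] Fa_cmp_assoc[OF b(2) l(3) h])
  finally show ?thesis
    using l(1) J.cmp_in_hom[OF a(1) l(2)] J.cmp_in_hom[OF b(2) l(3)]
    unfolding eventually_eq_def eqs fst_conv snd_conv by blast
qed

lemma eventually_eq_refl:
  assumes "x \<in> H Y"
  shows "eventually_eq x x"
proof -
  have "fst x \<in> Ob J" using assms by (auto simp: hom_union_def)
  then show ?thesis
    using J.ide_in_hom unfolding eventually_eq_def by blast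
qed

lemma eventually_eq_sym: "eventually_eq x y \<Longrightarrow> eventually_eq y x"
  unfolding eventually_eq_def by (elim bexE, intro bexI) (rule sym, assumption+)

lemma step_iff:
  "(x, y) \<in> step Y \<longleftrightarrow> x \<in> H Y \<and> (\<exists>u\<in>hom J (fst x) (fst y). snd y = Fa u \<cdot> snd x)"
  using J.hom_tgt by (cases x; cases y) (fastforce simp: hom_step_def hom_union_def)

lemma step_H:
  assumes "(x, y) \<in> step Y"
  shows "y \<in> H Y"
  using assms cmp_in_hom Fa_hom
  by (cases x; cases y) (force simp: hom_step_def hom_union_def)

lemma step_eventually_eq:
  assumes "(x, y) \<in> step Y"
  shows "eventually_eq x y"
proof -
  obtain u where x: "x \<in> H Y" and u: "u \<in> hom J (fst x) (fst y)" and y: "snd y = Fa u \<cdot> snd x"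
    using assms by (auto simp: step_iff)
  have y': "y \<in> H Y" by (rule step_H[OF assms])
  then have "snd y \<in> hom C Y (Fo (fst y))" "fst y \<in> Ob J" by (auto simp: hom_union_def)
  moreover have "Fa (ide J (fst y)) = ide C (Fo (fst y))"
    using func calculation(2) by (simp add: cat_functor_def)
  ultimately show ?thesis
    using u y J.ide_in_hom ide_cmp unfolding eventually_eq_def by metis
qed

text \<open>A zigzag contracts to a single cospan because eventual equality contains every step and
  is symmetric and transitive. Conversely, both elements reach their common image by one step
  each.\<close>

lemma gen_iff: "(x, y) \<in> gen Y \<longleftrightarrow> x \<in> H Y \<and> y \<in> H Y \<and> eventually_eq x y"
proof
  assume xy: "(x, y) \<in> gen Y"
  then have x: "x \<in> H Y" and rel: "(x, y) \<in> (step Y \<union> (step Y)\<inverse>)\<^sup>*" by auto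
  from rel have "y \<in> H Y \<and> eventually_eq x y"
  proof (induction rule: rtrancl_induct)
    case base
    show ?case using x eventually_eq_refl by blast
  next
    case (step y z)
    then have y: "y \<in> H Y" "eventually_eq x y" by auto
    have "z \<in> H Y" "eventually_eq y z"
      using step(2) y(1) step_H step_eventually_eq eventually_eq_sym step_iff by blast+
    then show ?case using eventually_eq_trans x y by blast
  qed
  with x show "x \<in> H Y \<and> y \<in> H Y \<and> eventually_eq x y" by blast
next
  assume *: "x \<in> H Y \<and> y \<in> H Y \<and> eventually_eq x y"
  then obtain k u v where k: "k \<in> Ob J" "u \<in> hom J (fst x) k" "v \<in> hom J (fst y) k"
    "Fa u \<cdot> snd x = Fa v \<cdot> snd y"
    unfolding eventually_eq_def by blast
  have "(x, (k, Fa u \<cdot> snd x)) \<in> step Y" "(y, (k, Fa u \<cdot> snd x)) \<in> step Y"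
    using * k by (auto simp: step_iff intro!: bexI)
  then have "(x, y) \<in> (step Y \<union> (step Y)\<inverse>)\<^sup>*"
    by (meson UnI1 UnI2 converse_iff r_into_rtrancl rtrancl_trans)
  with * show "(x, y) \<in> gen Y" by blast
qed

lemma equiv_gen: "equiv (H Y) (gen Y)"
proof (rule equivI)
  show "refl_on (H Y) (gen Y)"
    by (auto simp: refl_on_def)
  show "sym (gen Y)"
    by (rule symI) (simp only: gen_iff eventually_eq_sym)
  show "trans (gen Y)"
    by (rule transI, simp only: gen_iff) (elim conjE, intro conjI, assumption+, rule eventually_eq_trans)
qed auto

lemma hom_colim_map_class:
  assumes "j \<in> Ob J" "f \<in> hom C Y (Fo j)"
  shows "hom_colim_map C \<iota> (gen Y `` {(j, f)}) = \<iota> j \<cdot> f"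
proof -
  have *: "\<iota> k \<cdot> g = \<iota> j \<cdot> f" if "((j, f), (k, g)) \<in> gen Y" for k g
  proof -
    have "(k, g) \<in> H Y" and "eventually_eq (j, f) (k, g)"
      using that by (simp_all only: gen_iff)
    then obtain l u v where g: "g \<in> hom C Y (Fo k)"
      and "u \<in> hom J j l" "v \<in> hom J k l" "Fa u \<cdot> f = Fa v \<cdot> g"
      unfolding eventually_eq_def hom_union_def by auto
    then show ?thesis
      using \<iota>_Fa[of u j l f Y] \<iota>_Fa[of v k l g Y] assms g by simp
  qed
  have "(j, f) \<in> H Y"
    using assms by (simp add: hom_union_def)
  then have refl: "((j, f), (j, f)) \<in> gen Y"
    by (simp only: gen_iff eventually_eq_refl)
  have "(\<lambda>(j, f). \<iota> j \<cdot> f) ` (gen Y `` {(j, f)}) = {\<iota> j \<cdot> f}"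
  proof (rule set_eqI)
    fix x
    show "x \<in> (\<lambda>(j, f). \<iota> j \<cdot> f) ` (gen Y `` {(j, f)}) \<longleftrightarrow> x \<in> {\<iota> j \<cdot> f}"
    proof
      assume "x \<in> (\<lambda>(j, f). \<iota> j \<cdot> f) ` (gen Y `` {(j, f)})"
      then obtain y where y: "((j, f), y) \<in> gen Y" "x = (case y of (j, f) \<Rightarrow> \<iota> j \<cdot> f)"
        by blast
      show "x \<in> {\<iota> j \<cdot> f}"
        using y *[of "fst y" "snd y"] by (simp only: prod.collapse case_prod_beta singleton_iff)
    next
      assume "x \<in> {\<iota> j \<cdot> f}"
      then show "x \<in> (\<lambda>(j, f). \<iota> j \<cdot> f) ` (gen Y `` {(j, f)})"
        by (intro image_eqI[OF _ ImageI[OF refl]]) simp_all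
    qed
  qed
  then show ?thesis
    by (simp only: hom_colim_map_def the_elem_eq)
qed

lemma hom_colim_eq: "hom_colim C Y J Fo Fa = (\<lambda>x. gen Y `` {x}) ` H Y"
  by (auto simp: hom_colim_def quotient_def)

text \<open>Bijectivity of the canonical map in terms of elements, surjectivity first and
  injectivity second. The finiteness arguments work with these two properties and never with the
  quotient again.\<close>

lemma hom_commutes_with_iff:
  "hom_commutes_with C Y J Fo Fa L \<iota> \<longleftrightarrow>
    (\<forall>f\<in>hom C Y L. \<exists>j\<in>Ob J. \<exists>g\<in>hom C Y (Fo j). \<iota> j \<cdot> g = f) \<and>
    (\<forall>i\<in>Ob J. \<forall>j\<in>Ob J. \<forall>f\<in>hom C Y (Fo i). \<forall>g\<in>hom C Y (Fo j). \<iota> i \<cdot> f = \<iota> j \<cdot> g \<longrightarrow>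
      (\<exists>k\<in>Ob J. \<exists>u\<in>hom J i k. \<exists>v\<in>hom J j k. Fa u \<cdot> f = Fa v \<cdot> g))" (is "_ \<longleftrightarrow> ?surj \<and> ?inj")
proof -
  define m where "m = (\<lambda>(j, f). \<iota> j \<cdot> f)"
  have m: "hom_colim_map C \<iota> (gen Y `` {x}) = m x" if "x \<in> H Y" for x
    using that hom_colim_map_class by (auto simp: hom_union_def m_def)
  have m_hom: "m x \<in> hom C Y L" if "x \<in> H Y" for x
    using that cmp_in_hom \<iota>_hom by (auto simp: hom_union_def m_def)
  have cls: "gen Y `` {x} = gen Y `` {y} \<longleftrightarrow> eventually_eq x y" if "x \<in> H Y" "y \<in> H Y" for x y
    using eq_equiv_class_iff[OF equiv_gen that] gen_iff that by metis
  have img: "hom_colim_map C \<iota> ` hom_colim C Y J Fo Fa = m ` H Y"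
    by (simp add: hom_colim_eq image_image m cong: image_cong_simp)
  have "f \<in> m ` H Y \<longleftrightarrow> (\<exists>j\<in>Ob J. \<exists>g\<in>hom C Y (Fo j). \<iota> j \<cdot> g = f)" for f
    by (auto simp: m_def hom_union_def image_iff)
  then have "hom_colim_map C \<iota> ` hom_colim C Y J Fo Fa = hom C Y L \<longleftrightarrow> ?surj"
    using m_hom unfolding img by blast
  moreover have "inj_on (hom_colim_map C \<iota>) (hom_colim C Y J Fo Fa) \<longleftrightarrow>
      (\<forall>x\<in>H Y. \<forall>y\<in>H Y. m x = m y \<longrightarrow> eventually_eq x y)"
    unfolding inj_on_def hom_colim_eq by (auto simp: m cls)
  moreover have "(\<forall>x\<in>H Y. \<forall>y\<in>H Y. m x = m y \<longrightarrow> eventually_eq x y) \<longleftrightarrow> ?inj"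
    unfolding m_def hom_union_def eventually_eq_def by (simp add: split_paired_Ball_Sigma) blast
  ultimately show ?thesis
    unfolding hom_commutes_with_def bij_betw_def by blast
qed

end

section \<open>Finiteness as a factorization property\<close>

context category
begin

lemma filtered_coconeI:
  assumes "small_category \<kappa> J \<and> filtered J \<and> cat_functor J C Fo Fa \<and> is_colimit J C Fo Fa L \<iota>"
  shows "filtered_cocone C J Fo Fa L \<iota>"
  using assms category_self
  by (auto simp: filtered_cocone_def filtered_cocone_axioms_def small_category_def is_colimit_cocone)

text \<open>The index category may live on any types here, since this is applied to the poset of
  complexes, whose objects are sets of cells.\<close>

lemma categorically_finite_surj:
  fixes \<kappa> :: "'k rel" and J :: "('j, 'b) cat"
  assumes \<kappa>: "size_cardinal \<kappa>" and Y: "categorically_finite \<kappa> C Y"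
    and J: "small_category \<kappa> J" "filtered J" "cat_functor J C Fo Fa" "is_colimit J C Fo Fa L \<iota>"
    and f: "f \<in> hom C Y L"
  obtains j g where "j \<in> Ob J" "g \<in> hom C Y (Fo j)" "\<iota> j \<cdot> g = f"
proof -
  obtain p :: "'j \<Rightarrow> 'k" and q :: "'b \<Rightarrow> 'k" where "relabelling J p q"
    using small_category_relabelling[OF \<kappa> J(1)] by blast
  then interpret relabelling J p q .
  have *: "small_category \<kappa> J' \<and> filtered J' \<and> cat_functor J' C (Fo \<circ> p') (Fa \<circ> q') \<and>
      is_colimit J' C (Fo \<circ> p') (Fa \<circ> q') L (\<iota> \<circ> p')"
    using J by (simp add: small_relabel filtered_relabel functor_relabel
        is_colimit_relabel[of "\<iota> \<circ> p'" \<iota>] p'p)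
  then interpret F: filtered_cocone C J' "Fo \<circ> p'" "Fa \<circ> q'" L "\<iota> \<circ> p'"
    by (rule filtered_coconeI)
  have "hom_commutes_with C Y J' (Fo \<circ> p') (Fa \<circ> q') L (\<iota> \<circ> p')"
    using * Y unfolding categorically_finite_def by blast
  then obtain x g where x: "x \<in> Ob J'" "g \<in> hom C Y ((Fo \<circ> p') x)" "(\<iota> \<circ> p') x \<cdot> g = f"
    using f unfolding F.hom_commutes_with_iff by blast
  then obtain j where "j \<in> Ob J" "x = p j" by (auto simp: Ob')
  with x show ?thesis by (intro that[of j g]) (auto simp: p'p)
qed

lemma categorically_finiteI:
  fixes \<kappa> :: "'k rel"
  assumes "Y \<in> Ob C"
    and "\<And>(J :: ('k, 'k) cat) Fo Fa L \<iota> f. small_category \<kappa> J \<Longrightarrow> filtered_cocone C J Fo Fa L \<iota> \<Longrightarrow>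
      is_colimit J C Fo Fa L \<iota> \<Longrightarrow> f \<in> hom C Y L \<Longrightarrow>
      \<exists>j\<in>Ob J. \<exists>g\<in>hom C Y (Fo j). \<iota> j \<cdot> g = f"
    and "\<And>(J :: ('k, 'k) cat) Fo Fa L \<iota> i j f g. small_category \<kappa> J \<Longrightarrow> filtered_cocone C J Fo Fa L \<iota> \<Longrightarrow>
      is_colimit J C Fo Fa L \<iota> \<Longrightarrow> i \<in> Ob J \<Longrightarrow> j \<in> Ob J \<Longrightarrow>
      f \<in> hom C Y (Fo i) \<Longrightarrow> g \<in> hom C Y (Fo j) \<Longrightarrow> \<iota> i \<cdot> f = \<iota> j \<cdot> g \<Longrightarrow>
      \<exists>k\<in>Ob J. \<exists>u\<in>hom J i k. \<exists>v\<in>hom J j k. Fa u \<cdot> f = Fa v \<cdot> g"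
  shows "categorically_finite \<kappa> C Y"
  unfolding categorically_finite_def
proof (intro conjI allI impI)
  show "Y \<in> Ob C" by fact
next
  fix J :: "('k, 'k) cat" and Fo Fa L \<iota>
  assume *: "small_category \<kappa> J \<and> filtered J \<and> cat_functor J C Fo Fa \<and> is_colimit J C Fo Fa L \<iota>"
  then have F: "filtered_cocone C J Fo Fa L \<iota>"
    by (rule filtered_coconeI)
  show "hom_commutes_with C Y J Fo Fa L \<iota>"
    unfolding filtered_cocone.hom_commutes_with_iff[OF F]
    using assms(2)[OF _ F] assms(3)[OF _ F] * by simp
qed

lemma categorically_finite_factor:
  fixes \<kappa> :: "'k rel" and J :: "('k, 'k) cat"
  assumes Y: "categorically_finite \<kappa> C Y" and F: "filtered_cocone C J Fo Fa L \<iota>"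
    and J: "small_category \<kappa> J" "is_colimit J C Fo Fa L \<iota>"
  shows "f \<in> hom C Y L \<Longrightarrow> \<exists>j\<in>Ob J. \<exists>g\<in>hom C Y (Fo j). \<iota> j \<cdot> g = f"
    and "i \<in> Ob J \<Longrightarrow> j \<in> Ob J \<Longrightarrow> h \<in> hom C Y (Fo i) \<Longrightarrow> g \<in> hom C Y (Fo j) \<Longrightarrow> \<iota> i \<cdot> h = \<iota> j \<cdot> g
      \<Longrightarrow> \<exists>k\<in>Ob J. \<exists>u\<in>hom J i k. \<exists>v\<in>hom J j k. Fa u \<cdot> h = Fa v \<cdot> g"
proof -
  have "hom_commutes_with C Y J Fo Fa L \<iota>"
    using Y J filtered_cocone.filt[OF F] filtered_cocone.func[OF F]
    unfolding categorically_finite_def by blast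
  note this[unfolded filtered_cocone.hom_commutes_with_iff[OF F]]
  then show "f \<in> hom C Y L \<Longrightarrow> \<exists>j\<in>Ob J. \<exists>g\<in>hom C Y (Fo j). \<iota> j \<cdot> g = f"
    and "i \<in> Ob J \<Longrightarrow> j \<in> Ob J \<Longrightarrow> h \<in> hom C Y (Fo i) \<Longrightarrow> g \<in> hom C Y (Fo j) \<Longrightarrow> \<iota> i \<cdot> h = \<iota> j \<cdot> g
      \<Longrightarrow> \<exists>k\<in>Ob J. \<exists>u\<in>hom J i k. \<exists>v\<in>hom J j k. Fa u \<cdot> h = Fa v \<cdot> g"
    by blast+
qed

end


section \<open>Retracts of finite CW objects\<close>

context category
begin

lemma is_pushoutD:
  assumes "is_pushout C i f g h"
  shows "i \<in> hom C (src C i) (tgt C i)" "f \<in> hom C (src C f) (tgt C f)"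
    "g \<in> hom C (src C i) (src C f)" "h \<in> hom C (tgt C i) (tgt C f)" "f \<cdot> g = h \<cdot> i"
  using assms by (auto simp: is_pushout_def hom_def)

lemma pushout_factor:
  assumes "is_pushout C i f g h" "p \<in> hom C (src C f) T" "q \<in> hom C (tgt C i) T" "p \<cdot> g = q \<cdot> i"
  obtains t where "t \<in> hom C (tgt C f) T" "t \<cdot> f = p" "t \<cdot> h = q"
  using assms unfolding is_pushout_def by blast

lemma pushout_unique:
  assumes po: "is_pushout C i f g h" and t: "t \<in> hom C (tgt C f) T" "t' \<in> hom C (tgt C f) T"
    and eq: "t \<cdot> f = t' \<cdot> f" "t \<cdot> h = t' \<cdot> h"
  shows "t = t'"
proof -
  note D = is_pushoutD[OF po]
  have "(t \<cdot> f) \<cdot> g = (t \<cdot> h) \<cdot> i"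
    using cmp_assoc[OF D(3,2) t(1)] cmp_assoc[OF D(1,4) t(1)] D(5) by simp
  then have "\<exists>!x. x \<in> hom C (tgt C f) T \<and> x \<cdot> f = t \<cdot> f \<and> x \<cdot> h = t \<cdot> h"
    using po cmp_in_hom[OF D(2) t(1)] cmp_in_hom[OF D(4) t(1)] unfolding is_pushout_def by blast
  then show ?thesis
    using t eq by metis
qed

section \<open>Finiteness of initial objects, retracts and pushouts\<close>

lemma initial_unique: "initial C Z \<Longrightarrow> f \<in> hom C Z X \<Longrightarrow> g \<in> hom C Z X \<Longrightarrow> f = g"
  unfolding initial_def using hom_tgt by metis

lemma initial_map:
  assumes "initial C Z" "X \<in> Ob C"
  obtains f where "f \<in> hom C Z X"
  using assms unfolding initial_def by metis

text \<open>All hom sets out of \<open>Z\<close> are singletons, so it suffices that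
  \<open>J\<close> is nonempty and that any two indices have an upper bound.\<close>

lemma categorically_finite_initial:
  fixes \<kappa> :: "'k rel"
  assumes Z: "initial C Z"
  shows "categorically_finite \<kappa> C Z"
proof (rule categorically_finiteI)
  show "Z \<in> Ob C" using Z by (simp add: initial_def)
next
  fix J :: "('k, 'k) cat" and Fo Fa L \<iota> f
  assume F: "filtered_cocone C J Fo Fa L \<iota>" and f: "f \<in> hom C Z L"
  interpret filtered_cocone C J Fo Fa L \<iota> by fact
  obtain j where j: "j \<in> Ob J" using filt by (auto simp: filtered_def)
  obtain g where g: "g \<in> hom C Z (Fo j)" using initial_map[OF Z cat_functor_Ob[OF func j]] .
  have "\<iota> j \<cdot> g = f" using initial_unique[OF Z cmp_in_hom[OF g \<iota>_hom[OF j]] f] .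
  with j g show "\<exists>j\<in>Ob J. \<exists>g\<in>hom C Z (Fo j). \<iota> j \<cdot> g = f" by blast
next
  fix J :: "('k, 'k) cat" and Fo Fa L \<iota> i j f g
  assume F: "filtered_cocone C J Fo Fa L \<iota>" and ij: "i \<in> Ob J" "j \<in> Ob J"
    and fg: "f \<in> hom C Z (Fo i)" "g \<in> hom C Z (Fo j)"
  interpret filtered_cocone C J Fo Fa L \<iota> by fact
  obtain k u v where k: "k \<in> Ob J" "u \<in> hom J i k" "v \<in> hom J j k" using ub[OF ij] .
  have "Fa u \<cdot> f = Fa v \<cdot> g"
    using initial_unique[OF Z cmp_in_hom[OF fg(1) Fa_hom[OF k(2)]] cmp_in_hom[OF fg(2) Fa_hom[OF k(3)]]] .
  with k show "\<exists>k\<in>Ob J. \<exists>u\<in>hom J i k. \<exists>v\<in>hom J j k. Fa u \<cdot> f = Fa v \<cdot> g" by blast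
qed

text \<open>Precomposition with \<open>r\<close> and \<open>s\<close> makes \<open>C(Y, _)\<close> a
  natural retract of \<open>C(Z, _)\<close>: solve each problem for \<open>Z\<close> after composing
  with \<open>r\<close>, then compose with \<open>s\<close>.\<close>

lemma categorically_finite_retract:
  fixes \<kappa> :: "'k rel"
  assumes fin: "categorically_finite \<kappa> C Z" and ret: "retract C Y Z"
  shows "categorically_finite \<kappa> C Y"
proof -
  obtain s r where s: "s \<in> hom C Y Z" and r: "r \<in> hom C Z Y" and rs: "r \<cdot> s = ide C Y"
    using ret by (auto simp: retract_def)
  have frs: "(f \<cdot> r) \<cdot> s = f" if "f \<in> hom C Y X" for f X
    using cmp_assoc[OF s r that] cmp_ide[OF that] by (simp add: rs)
  show ?thesis
  proof (rule categorically_finiteI)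
    show "Y \<in> Ob C" using ret by (simp add: retract_def)
  next
    fix J :: "('k, 'k) cat" and Fo Fa L \<iota> f
    assume J: "small_category \<kappa> J" and F: "filtered_cocone C J Fo Fa L \<iota>"
      and L: "is_colimit J C Fo Fa L \<iota>" and f: "f \<in> hom C Y L"
    interpret filtered_cocone C J Fo Fa L \<iota> by fact
    obtain j g where g: "j \<in> Ob J" "g \<in> hom C Z (Fo j)" "\<iota> j \<cdot> g = f \<cdot> r"
      using categorically_finite_factor(1)[OF fin F J L cmp_in_hom[OF r f]] by blast
    have "\<iota> j \<cdot> (g \<cdot> s) = f"
      using cmp_assoc[OF s g(2) \<iota>_hom[OF g(1)]] frs[OF f] by (simp add: g(3))
    with g cmp_in_hom[OF s g(2)] show "\<exists>j\<in>Ob J. \<exists>g\<in>hom C Y (Fo j). \<iota> j \<cdot> g = f" by blast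
  next
    fix J :: "('k, 'k) cat" and Fo Fa L \<iota> i j f g
    assume J: "small_category \<kappa> J" and F: "filtered_cocone C J Fo Fa L \<iota>"
      and L: "is_colimit J C Fo Fa L \<iota>" and ij: "i \<in> Ob J" "j \<in> Ob J"
      and f: "f \<in> hom C Y (Fo i)" and g: "g \<in> hom C Y (Fo j)" and fg: "\<iota> i \<cdot> f = \<iota> j \<cdot> g"
    interpret filtered_cocone C J Fo Fa L \<iota> by fact
    have "\<iota> i \<cdot> (f \<cdot> r) = \<iota> j \<cdot> (g \<cdot> r)"
      using cmp_assoc[OF r f \<iota>_hom[OF ij(1)]] cmp_assoc[OF r g \<iota>_hom[OF ij(2)]] fg by simp
    then obtain k u v where k: "k \<in> Ob J" "u \<in> hom J i k" "v \<in> hom J j k"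
        "Fa u \<cdot> (f \<cdot> r) = Fa v \<cdot> (g \<cdot> r)"
      using categorically_finite_factor(2)[OF fin F J L ij cmp_in_hom[OF r f] cmp_in_hom[OF r g]]
      by blast
    have "Fa u \<cdot> f = Fa v \<cdot> g"
      using k(4) cmp_assoc[OF s cmp_in_hom[OF r f] Fa_hom[OF k(2)]]
        cmp_assoc[OF s cmp_in_hom[OF r g] Fa_hom[OF k(3)]] frs[OF f] frs[OF g] by simp
    with k show "\<exists>k\<in>Ob J. \<exists>u\<in>hom J i k. \<exists>v\<in>hom J j k. Fa u \<cdot> f = Fa v \<cdot> g" by blast
  qed
qed

text \<open>Maps out of a pushout form a fibre product of hom sets, and filtered colimits of sets
  commute with finite limits; the proof does this by elements. For surjectivity, both legs factor
  through stages, and finiteness of \<open>src C i\<close> makes the factorizations agree on it at a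
  later stage. For injectivity, the legs are compared separately and the two comparisons
  amalgamated.\<close>

lemma categorically_finite_pushout:
  fixes \<kappa> :: "'k rel"
  assumes po: "is_pushout C i f g h"
    and fin: "categorically_finite \<kappa> C (src C i)" "categorically_finite \<kappa> C (tgt C i)"
      "categorically_finite \<kappa> C (src C f)"
  shows "categorically_finite \<kappa> C (tgt C f)"
proof (rule categorically_finiteI)
  note D = is_pushoutD[OF po]
  show "tgt C f \<in> Ob C" using hom_tgt[OF D(2)] .
  {
    fix J :: "('k, 'k) cat" and Fo Fa L \<iota> t
    assume J: "small_category \<kappa> J" and F: "filtered_cocone C J Fo Fa L \<iota>"
      and L: "is_colimit J C Fo Fa L \<iota>" and t: "t \<in> hom C (tgt C f) L"
    interpret filtered_cocone C J Fo Fa L \<iota> by fact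
    obtain j1 p where p: "j1 \<in> Ob J" "p \<in> hom C (src C f) (Fo j1)" "\<iota> j1 \<cdot> p = t \<cdot> f"
      using categorically_finite_factor(1)[OF fin(3) F J L cmp_in_hom[OF D(2) t]] by blast
    obtain j2 q where q: "j2 \<in> Ob J" "q \<in> hom C (tgt C i) (Fo j2)" "\<iota> j2 \<cdot> q = t \<cdot> h"
      using categorically_finite_factor(1)[OF fin(2) F J L cmp_in_hom[OF D(4) t]] by blast
    have pg: "p \<cdot> g \<in> hom C (src C i) (Fo j1)" and qi: "q \<cdot> i \<in> hom C (src C i) (Fo j2)"
      using cmp_in_hom D p q by blast+
    have "\<iota> j1 \<cdot> (p \<cdot> g) = \<iota> j2 \<cdot> (q \<cdot> i)"
      using cmp_assoc[OF D(3) p(2) \<iota>_hom[OF p(1)]] cmp_assoc[OF D(1) q(2) \<iota>_hom[OF q(1)]]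
        cmp_assoc[OF D(3,2) t] cmp_assoc[OF D(1,4) t] p q D(5) by simp
    then obtain k u v where k: "k \<in> Ob J" "u \<in> hom J j1 k" "v \<in> hom J j2 k"
        "Fa u \<cdot> (p \<cdot> g) = Fa v \<cdot> (q \<cdot> i)"
      using categorically_finite_factor(2)[OF fin(1) F J L p(1) q(1) pg qi] by blast
    note up = cmp_in_hom[OF p(2) Fa_hom[OF k(2)]] and vq = cmp_in_hom[OF q(2) Fa_hom[OF k(3)]]
    have "(Fa u \<cdot> p) \<cdot> g = (Fa v \<cdot> q) \<cdot> i"
      using k(4) cmp_assoc[OF D(3) p(2) Fa_hom[OF k(2)]] cmp_assoc[OF D(1) q(2) Fa_hom[OF k(3)]]
      by simp
    then obtain t' where t': "t' \<in> hom C (tgt C f) (Fo k)" "t' \<cdot> f = Fa u \<cdot> p" "t' \<cdot> h = Fa v \<cdot> q"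
      using pushout_factor[OF po up vq] by blast
    have "\<iota> k \<cdot> t' = t"
    proof (rule pushout_unique[OF po cmp_in_hom[OF t'(1) \<iota>_hom[OF k(1)]] t])
      show "(\<iota> k \<cdot> t') \<cdot> f = t \<cdot> f"
        using cmp_assoc[OF D(2) t'(1) \<iota>_hom[OF k(1)]] \<iota>_Fa[OF k(2) p(2)] by (simp add: t' p)
      show "(\<iota> k \<cdot> t') \<cdot> h = t \<cdot> h"
        using cmp_assoc[OF D(4) t'(1) \<iota>_hom[OF k(1)]] \<iota>_Fa[OF k(3) q(2)] by (simp add: t' q)
    qed
    with k t' show "\<exists>j\<in>Ob J. \<exists>g\<in>hom C (tgt C f) (Fo j). \<iota> j \<cdot> g = t" by blast
  next
    fix J :: "('k, 'k) cat" and Fo Fa L \<iota> a b s t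
    assume J: "small_category \<kappa> J" and F: "filtered_cocone C J Fo Fa L \<iota>"
      and L: "is_colimit J C Fo Fa L \<iota>" and ab: "a \<in> Ob J" "b \<in> Ob J"
      and s: "s \<in> hom C (tgt C f) (Fo a)" and t: "t \<in> hom C (tgt C f) (Fo b)"
      and st: "\<iota> a \<cdot> s = \<iota> b \<cdot> t"
    interpret filtered_cocone C J Fo Fa L \<iota> by fact
    note \<iota>a = \<iota>_hom[OF ab(1)] and \<iota>b = \<iota>_hom[OF ab(2)]
    have "\<iota> a \<cdot> (s \<cdot> f) = \<iota> b \<cdot> (t \<cdot> f)"
      using cmp_assoc[OF D(2) s \<iota>a] cmp_assoc[OF D(2) t \<iota>b] st by simp
    then obtain k1 u1 v1 where k1: "u1 \<in> hom J a k1" "v1 \<in> hom J b k1"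
        "Fa u1 \<cdot> (s \<cdot> f) = Fa v1 \<cdot> (t \<cdot> f)"
      using categorically_finite_factor(2)[OF fin(3) F J L ab cmp_in_hom[OF D(2) s] cmp_in_hom[OF D(2) t]]
      by blast
    have "\<iota> a \<cdot> (s \<cdot> h) = \<iota> b \<cdot> (t \<cdot> h)"
      using cmp_assoc[OF D(4) s \<iota>a] cmp_assoc[OF D(4) t \<iota>b] st by simp
    then obtain k2 u2 v2 where k2: "u2 \<in> hom J a k2" "v2 \<in> hom J b k2"
        "Fa u2 \<cdot> (s \<cdot> h) = Fa v2 \<cdot> (t \<cdot> h)"
      using categorically_finite_factor(2)[OF fin(2) F J L ab cmp_in_hom[OF D(4) s] cmp_in_hom[OF D(4) t]]
      by blast
    obtain l w1 w2 where l: "l \<in> Ob J" "w1 \<in> hom J k1 l" "w2 \<in> hom J k2 l"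
        "cmp J w1 u1 = cmp J w2 u2" "cmp J w1 v1 = cmp J w2 v2"
      using amalgamate2[OF k1(1,2) k2(1,2)] .
    let ?u = "cmp J w1 u1" and ?v = "cmp J w1 v1"
    note U = J.cmp_in_hom[OF k1(1) l(2)] and V = J.cmp_in_hom[OF k1(2) l(2)]
    have "Fa ?u \<cdot> s = Fa ?v \<cdot> t"
    proof (rule pushout_unique[OF po cmp_in_hom[OF s Fa_hom[OF U]] cmp_in_hom[OF t Fa_hom[OF V]]])
      have "Fa ?u \<cdot> (s \<cdot> f) = Fa ?v \<cdot> (t \<cdot> f)"
        using Fa_cmp_assoc[OF k1(1) l(2) cmp_in_hom[OF D(2) s]]
          Fa_cmp_assoc[OF k1(2) l(2) cmp_in_hom[OF D(2) t]] k1(3) by simp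
      then show "(Fa ?u \<cdot> s) \<cdot> f = (Fa ?v \<cdot> t) \<cdot> f"
        using cmp_assoc[OF D(2) s Fa_hom[OF U]] cmp_assoc[OF D(2) t Fa_hom[OF V]] by simp
      have "Fa ?u \<cdot> (s \<cdot> h) = Fa ?v \<cdot> (t \<cdot> h)"
        using Fa_cmp_assoc[OF k2(1) l(3) cmp_in_hom[OF D(4) s]]
          Fa_cmp_assoc[OF k2(2) l(3) cmp_in_hom[OF D(4) t]] k2(3) by (simp add: l)
      then show "(Fa ?u \<cdot> s) \<cdot> h = (Fa ?v \<cdot> t) \<cdot> h"
        using cmp_assoc[OF D(4) s Fa_hom[OF U]] cmp_assoc[OF D(4) t Fa_hom[OF V]] by simp
    qed
    with l U V show "\<exists>k\<in>Ob J. \<exists>u\<in>hom J a k. \<exists>v\<in>hom J b k. Fa u \<cdot> s = Fa v \<cdot> t" by blast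
  }
qed

text \<open>This is the left lifting property of the map from the initial object to \<open>Z\<close> against \<open>P\<close>;
  the upper left triangle of the lifting square commutes automatically.\<close>

definition lifts_through :: "'a set \<Rightarrow> 'o \<Rightarrow> bool" where
  "lifts_through P Z \<longleftrightarrow> (\<forall>p\<in>P. \<forall>v\<in>hom C Z (tgt C p). \<exists>h\<in>hom C Z (src C p). p \<cdot> h = v)"

lemma lifts_through_initial:
  assumes "initial C Z" "P \<subseteq> Mor C"
  shows "lifts_through P Z"
  unfolding lifts_through_def
proof (intro ballI)
  fix p v assume p: "p \<in> P" and v: "v \<in> hom C Z (tgt C p)"
  then have p': "p \<in> hom C (src C p) (tgt C p)" using assms(2) hom_self by blast
  obtain h where h: "h \<in> hom C Z (src C p)" using initial_map[OF assms(1) hom_src[OF p']] .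
  then show "\<exists>h\<in>hom C Z (src C p). p \<cdot> h = v"
    using initial_unique[OF assms(1) cmp_in_hom[OF h p'] v] by blast
qed

lemma lifts_through_retract:
  assumes P: "P \<subseteq> Mor C" and Z: "lifts_through P Z" and ret: "retract C Y Z"
  shows "lifts_through P Y"
  unfolding lifts_through_def
proof (intro ballI)
  fix p v assume p: "p \<in> P" and v: "v \<in> hom C Y (tgt C p)"
  have p': "p \<in> hom C (src C p) (tgt C p)" using P p hom_self by blast
  obtain s r where s: "s \<in> hom C Y Z" and r: "r \<in> hom C Z Y" and rs: "r \<cdot> s = ide C Y"
    using ret by (auto simp: retract_def)
  obtain h where h: "h \<in> hom C Z (src C p)" "p \<cdot> h = v \<cdot> r"
    using Z p cmp_in_hom[OF r v] unfolding lifts_through_def by blast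
  have "p \<cdot> (h \<cdot> s) = v"
    using cmp_assoc[OF s h(1) p'] cmp_assoc[OF s r v] cmp_ide[OF v] by (simp add: h rs)
  then show "\<exists>h\<in>hom C Y (src C p). p \<cdot> h = v"
    using cmp_in_hom[OF s h(1)] by blast
qed

lemma lifts_through_pushout:
  assumes P: "P \<subseteq> Mor C" and po: "is_pushout C i f g h"
    and i: "\<And>p. p \<in> P \<Longrightarrow> has_lift C i p" and X: "lifts_through P (src C f)"
  shows "lifts_through P (tgt C f)"
  unfolding lifts_through_def
proof (intro ballI)
  fix p v assume p: "p \<in> P" and v: "v \<in> hom C (tgt C f) (tgt C p)"
  note D = is_pushoutD[OF po]
  have p': "p \<in> hom C (src C p) (tgt C p)" using P p hom_self by blast
  obtain k where k: "k \<in> hom C (src C f) (src C p)" "p \<cdot> k = v \<cdot> f"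
    using X p cmp_in_hom[OF D(2) v] unfolding lifts_through_def by blast
  have "p \<cdot> (k \<cdot> g) = (v \<cdot> h) \<cdot> i"
    using cmp_assoc[OF D(3) k(1) p'] cmp_assoc[OF D(3,2) v] cmp_assoc[OF D(1,4) v] D(5) k(2) by simp
  \<comment> \<open>Taking \<open>k \<cdot> g\<close> as the upper edge makes the lift
    \<open>l\<close> compatible with \<open>k\<close>, so that the two glue over the
    pushout.\<close>
  then obtain l where l: "l \<in> hom C (tgt C i) (src C p)" "l \<cdot> i = k \<cdot> g" "p \<cdot> l = v \<cdot> h"
    using i[OF p] cmp_in_hom[OF D(3) k(1)] cmp_in_hom[OF D(4) v] unfolding has_lift_def by blast
  obtain t where t: "t \<in> hom C (tgt C f) (src C p)" "t \<cdot> f = k" "t \<cdot> h = l"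
    using pushout_factor[OF po k(1) l(1) l(2)[symmetric]] .
  have "p \<cdot> t = v"
  proof (rule pushout_unique[OF po cmp_in_hom[OF t(1) p'] v])
    show "(p \<cdot> t) \<cdot> f = v \<cdot> f" using cmp_assoc[OF D(2) t(1) p'] by (simp add: t k)
    show "(p \<cdot> t) \<cdot> h = v \<cdot> h" using cmp_assoc[OF D(4) t(1) p'] by (simp add: t l)
  qed
  with t show "\<exists>h\<in>hom C (tgt C f) (src C p). p \<cdot> h = v" by blast
qed

text \<open>The converse direction argues through this rule, so the filtration itself is handled
  only once.\<close>

lemma finite_CW_induct [consumes 1, case_names initial attach]:
  assumes "finite_CW C I Z"
    and init: "\<And>Z. initial C Z \<Longrightarrow> Q Z"
    and step: "\<And>i f g h. i \<in> I \<Longrightarrow> is_pushout C i f g h \<Longrightarrow> Q (src C f) \<Longrightarrow> Q (tgt C f)"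
  shows "Q Z"
proof -
  obtain n Zo za where Z: "initial C (Zo 0)" "Zo n = Z"
    and za: "\<And>k. k < n \<Longrightarrow> za k \<in> hom C (Zo k) (Zo (Suc k)) \<and> (\<exists>i\<in>I. pushout_of C i (za k))"
    using assms(1) unfolding finite_CW_def by blast
  have "k \<le> n \<Longrightarrow> Q (Zo k)" for k
  proof (induction k)
    case 0
    then show ?case using init Z by blast
  next
    case (Suc k)
    then obtain i g h where "i \<in> I" "is_pushout C i (za k) g h"
      using za[of k] unfolding pushout_of_def by auto
    moreover have "src C (za k) = Zo k" "tgt C (za k) = Zo (Suc k)"
      using za[of k] Suc.prems by (auto simp: hom_def)
    ultimately show ?case using step Suc by (metis Suc_leD)
  qed
  then show ?thesis using Z by blast
qed

lemma finite_CW_initial: "initial C Z \<Longrightarrow> finite_CW C I Z"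
  unfolding finite_CW_def by (intro exI[of _ 0] exI[of _ "\<lambda>_. Z"]) simp

lemma finite_CW_attach:
  assumes Z: "finite_CW C I Z" and i: "i \<in> I" and po: "is_pushout C i f g h" and f: "f \<in> hom C Z Z'"
  shows "finite_CW C I Z'"
proof -
  obtain n Zo za where "initial C (Zo 0)" "Zo n = Z"
    "\<And>k. k < n \<Longrightarrow> za k \<in> hom C (Zo k) (Zo (Suc k)) \<and> (\<exists>i\<in>I. pushout_of C i (za k))"
    using Z unfolding finite_CW_def by blast
  \<comment> \<open>The new object is stage \<open>Suc n\<close>, but the new arrow leaves stage
    \<open>n\<close>; hence the different update positions.\<close>
  then show ?thesis
    unfolding finite_CW_def using i po f
    by (intro exI[of _ "Suc n"] exI[of _ "Zo(Suc n := Z')"] exI[of _ "za(n := f)"])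
      (auto simp: less_Suc_eq pushout_of_def)
qed

end

section \<open>Cofibrancy from the lifting property, and the converse direction\<close>

context model_category
begin

text \<open>The map \<open>f\<close> is a retract of the cofibration in its factorization.\<close>

lemma lifting_imp_cofibration:
  assumes f: "f \<in> hom C X Y" and lift: "\<And>p. p \<in> W \<inter> Fib \<Longrightarrow> has_lift C f p"
  shows "f \<in> Cof"
proof -
  obtain V i p where i: "i \<in> hom C X V" "i \<in> Cof" and p: "p \<in> hom C V Y" "p \<in> W \<inter> Fib"
    and f_eq: "f = p \<cdot> i"
    using factorization_acyclic_fibration[OF f] by blast
  have st [simp]: "src C f = X" "tgt C f = Y" "src C p = V" "tgt C p = Y" "src C i = X" "tgt C i = V"
    using f i p by (auto simp: hom_def)
  have "p \<cdot> i = ide C Y \<cdot> f" using ide_cmp[OF f] f_eq by simp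
  then obtain h where h: "h \<in> hom C Y V" "h \<cdot> f = i" "p \<cdot> h = ide C Y"
    using lift[OF p(2)] i(1) ide_in_hom[OF hom_tgt[OF f]] unfolding has_lift_def by auto
  have "retract_map C f i"
    unfolding retract_map_def st
  proof (intro conjI bexI)
    show "f \<in> Mor C" "i \<in> Mor C" using f i by (auto simp: hom_def)
    show "ide C X \<cdot> ide C X = ide C X" "i \<cdot> ide C X = h \<cdot> f" "f \<cdot> ide C X = p \<cdot> i"
      "p \<cdot> h = ide C Y"
      using h f i f_eq cmp_ide ide_in_hom[OF hom_src[OF f]] by auto
    show "ide C X \<in> hom C X X" "ide C X \<in> hom C X X" using ide_in_hom[OF hom_src[OF f]] by blast+
    show "h \<in> hom C Y V" "p \<in> hom C V Y" by fact+
  qed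
  then show ?thesis using retracts i(2) by blast
qed

text \<open>Cofibrations are not followed through the pushouts. What passes through the induction
  and to the retract is the lifting property against acyclic fibrations, from which
  \<open>lifting_imp_cofibration\<close> recovers cofibrancy at the end.\<close>

lemma retract_finite_CW:
  assumes gen: "\<And>i p. i \<in> I \<Longrightarrow> p \<in> W \<inter> Fib \<Longrightarrow> has_lift C i p"
    and Z: "finite_CW C I Z" and ret: "retract C Y Z"
    and fin: "\<And>i. i \<in> I \<Longrightarrow> categorically_finite \<kappa> C (src C i) \<and> categorically_finite \<kappa> C (tgt C i)"
  shows "categorically_finite \<kappa> C Y" "cofibrant C Cof Y"
proof -
  have P: "W \<inter> Fib \<subseteq> Mor C" using classes by blast
  from Z have "categorically_finite \<kappa> C Z"
    by (induction rule: finite_CW_induct)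
      (use fin in \<open>auto intro: categorically_finite_initial categorically_finite_pushout\<close>)
  then show "categorically_finite \<kappa> C Y"
    using ret by (rule categorically_finite_retract)
  from Z have "lifts_through (W \<inter> Fib) Z"
    by (induction rule: finite_CW_induct)
      (use gen P in \<open>auto intro: lifts_through_initial lifts_through_pushout\<close>)
  then have lift: "lifts_through (W \<inter> Fib) Y"
    using lifts_through_retract[OF P _ ret] by blast
  obtain Z0 where Z0: "initial C Z0"
    using Z unfolding finite_CW_def by blast
  have "Y \<in> Ob C" using ret by (simp add: retract_def)
  then obtain f where f: "f \<in> hom C Z0 Y" using initial_map[OF Z0] by blast
  have "has_lift C f p" if p: "p \<in> W \<inter> Fib" for p
    unfolding has_lift_def
  proof (intro ballI impI)
    fix u v assume "u \<in> hom C (src C f) (src C p)" and "v \<in> hom C (tgt C f) (tgt C p)"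
    then have u: "u \<in> hom C Z0 (src C p)" and v: "v \<in> hom C Y (tgt C p)"
      using f by (auto simp: hom_def)
    obtain h where h: "h \<in> hom C Y (src C p)" "p \<cdot> h = v"
      using lift p v unfolding lifts_through_def by blast
    then show "\<exists>h\<in>hom C (tgt C f) (src C p). h \<cdot> f = u \<and> p \<cdot> h = v"
      using initial_unique[OF Z0 cmp_in_hom[OF f h(1)] u] f by (auto simp: hom_def)
  qed
  then have "f \<in> Cof" using lifting_imp_cofibration[OF f] by blast
  then show "cofibrant C Cof Y" using Z0 f unfolding cofibrant_def by blast
qed

end


section \<open>Finite complexes over an object\<close>

text \<open>
  A cell \<open>Cell b i a c\<close> over \<open>Y\<close> is attached along \<open>a\<close> to a finite complex \<open>R\<close> and mapped to \<open>Y\<close>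
  by \<open>c\<close>. The list \<open>b\<close> consists of the cells of \<open>R\<close> paired with their characteristic maps into \<open>R\<close>.
\<close>

datatype 'a cell = Cell (bd: "('a cell \<times> 'a) list") (gen: 'a) (att: 'a) (chr: 'a)

definition bds :: "'a cell \<Rightarrow> 'a cell set" where
  "bds c = fst ` set (bd c)"

text \<open>Boundaries are well founded. This decides the order in which cells are attached and
  stratifies the cells for counting.\<close>

lemma size_bds: "d \<in> bds c \<Longrightarrow> size d < size c"
proof -
  assume "d \<in> bds c"
  then obtain e where e: "(d, e) \<in> set (bd c)" by (auto simp: bds_def)
  \<comment> \<open>This is the size that the datatype assigns to its nested pairs; the arrows weigh
    nothing.\<close>
  have "size_prod size (\<lambda>_. 0) (d, e) \<le> size_list (size_prod size (\<lambda>_. 0)) (bd c)"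
    by (rule size_list_estimation'[OF e]) simp
  then show ?thesis by (cases c) simp
qed

context category
begin

text \<open>
  A compatible family \<open>x\<close> on a set \<open>S\<close> of cells is what defines a map to \<open>X\<close> out of the complex with
  cells \<open>S\<close>; that complex is defined, by \<open>realizes\<close>, as the object carrying the universal family.
\<close>

definition family :: "'a cell set \<Rightarrow> 'o \<Rightarrow> ('a cell \<Rightarrow> 'a) \<Rightarrow> bool" where
  "family S X x \<longleftrightarrow> X \<in> Ob C \<and> (\<forall>c\<in>S. gen c \<in> Mor C \<and>
     att c \<in> hom C (src C (gen c)) (tgt C (att c)) \<and> x c \<in> hom C (tgt C (gen c)) X \<and>
     (\<exists>m\<in>hom C (tgt C (att c)) X. m \<cdot> att c = x c \<cdot> gen c \<and>
       (\<forall>(d, e)\<in>set (bd c). e \<in> hom C (tgt C (gen d)) (tgt C (att c)) \<and> m \<cdot> e = x d)))"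

definition realizes :: "'a cell set \<Rightarrow> 'o \<Rightarrow> ('a cell \<Rightarrow> 'a) \<Rightarrow> bool" where
  "realizes S R e \<longleftrightarrow> family S R e \<and>
     (\<forall>X x. family S X x \<longrightarrow> (\<exists>!m. m \<in> hom C R X \<and> (\<forall>c\<in>S. m \<cdot> e c = x c)))"

lemma family_hom: "family S X x \<Longrightarrow> c \<in> S \<Longrightarrow> x c \<in> hom C (tgt C (gen c)) X"
  by (simp add: family_def)

lemma family_Ob: "family S X x \<Longrightarrow> X \<in> Ob C"
  by (simp add: family_def)

lemma family_subset: "family S X x \<Longrightarrow> T \<subseteq> S \<Longrightarrow> family T X x"
  unfolding family_def by blast

lemma family_comp:
  assumes x: "family S X x" and f: "f \<in> hom C X X'"
  shows "family S X' (\<lambda>c. f \<cdot> x c)"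
  unfolding family_def
proof (intro conjI ballI)
  show "X' \<in> Ob C" using hom_tgt[OF f] .
  fix c assume c: "c \<in> S"
  then obtain m where g: "gen c \<in> Mor C" and a: "att c \<in> hom C (src C (gen c)) (tgt C (att c))"
    and xc: "x c \<in> hom C (tgt C (gen c)) X" and m: "m \<in> hom C (tgt C (att c)) X"
    and ma: "m \<cdot> att c = x c \<cdot> gen c"
    and e: "\<And>d e. (d, e) \<in> set (bd c) \<Longrightarrow> e \<in> hom C (tgt C (gen d)) (tgt C (att c)) \<and> m \<cdot> e = x d"
    using x unfolding family_def by blast
  show "gen c \<in> Mor C" by fact
  show "att c \<in> hom C (src C (gen c)) (tgt C (att c))" by fact
  show "f \<cdot> x c \<in> hom C (tgt C (gen c)) X'" using cmp_in_hom[OF xc f] .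
  show "\<exists>m\<in>hom C (tgt C (att c)) X'. m \<cdot> att c = (f \<cdot> x c) \<cdot> gen c \<and>
      (\<forall>(d, e)\<in>set (bd c). e \<in> hom C (tgt C (gen d)) (tgt C (att c)) \<and> m \<cdot> e = f \<cdot> x d)"
  proof (intro bexI conjI ballI)
    show "f \<cdot> m \<in> hom C (tgt C (att c)) X'" using cmp_in_hom[OF m f] .
    show "(f \<cdot> m) \<cdot> att c = (f \<cdot> x c) \<cdot> gen c"
      using cmp_assoc[OF a m f] cmp_assoc[OF hom_self[OF g] xc f] ma by simp
    show "case de of (d, e) \<Rightarrow> e \<in> hom C (tgt C (gen d)) (tgt C (att c)) \<and> (f \<cdot> m) \<cdot> e = f \<cdot> x d"
      if "de \<in> set (bd c)" for de
      using e[of "fst de" "snd de"] that cmp_assoc[OF _ m f] by (cases de) auto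
  qed
qed

text \<open>The condition at a cell also reads the family on its boundary, so values outside
  \<open>S\<close> are irrelevant only because \<open>S\<close> is closed under boundaries.\<close>

lemma family_cong:
  assumes x: "family S X x" and closed: "\<And>c. c \<in> S \<Longrightarrow> bds c \<subseteq> S" and eq: "\<And>c. c \<in> S \<Longrightarrow> x c = y c"
  shows "family S X y"
proof -
  have "x (fst de) = y (fst de)" if "c \<in> S" "de \<in> set (bd c)" for c de
    using that closed[of c] eq by (auto simp: bds_def)
  then have "(\<forall>(d, e)\<in>set (bd c). e \<in> hom C (tgt C (gen d)) (tgt C (att c)) \<and> m \<cdot> e = x d) \<longleftrightarrow>
      (\<forall>(d, e)\<in>set (bd c). e \<in> hom C (tgt C (gen d)) (tgt C (att c)) \<and> m \<cdot> e = y d)"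
    if "c \<in> S" for c m
    using that by (intro ball_cong) (simp_all add: case_prod_beta)
  then show ?thesis
    using x unfolding family_def by (simp add: eq)
qed

lemma realizes_family: "realizes S R e \<Longrightarrow> family S R e"
  by (simp add: realizes_def)

lemma realizes_factor:
  assumes "realizes S R e" "family S X x"
  obtains m where "m \<in> hom C R X" "\<And>c. c \<in> S \<Longrightarrow> m \<cdot> e c = x c"
  using assms unfolding realizes_def by blast

lemma realizes_unique:
  assumes R: "realizes S R e" and m: "m \<in> hom C R X" "m' \<in> hom C R X"
    and eq: "\<And>c. c \<in> S \<Longrightarrow> m \<cdot> e c = m' \<cdot> e c"
  shows "m = m'"
proof -
  have "\<exists>!t. t \<in> hom C R X \<and> (\<forall>c\<in>S. t \<cdot> e c = m \<cdot> e c)"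
    using R family_comp[OF realizes_family[OF R] m(1)] unfolding realizes_def by blast
  then show ?thesis using m eq by metis
qed

end

section \<open>Cells and finite complexes over a fixed object\<close>

locale complexes_over = category C for C :: "('o, 'a) cat" (structure) +
  fixes \<kappa> :: "'k rel" and I :: "'a set" and Y :: 'o
  assumes size_cardinal: "size_cardinal \<kappa>"
    and cocomplete: "cocomplete \<kappa> C"
    and locally_small: "locally_small \<kappa> C"
    and I: "I \<subseteq> Mor C" "|I| <o \<kappa>"
    and Y: "Y \<in> Ob C"
begin

text \<open>Chosen for every set of cells at once, because \<open>cells\<close> is defined in terms
  of it; \<open>realization_exists\<close> justifies the choice on complexes. One fixed object
  \<open>R S\<close> is what lets attaching maps be arrows of \<open>C\<close> stored in a
  cell.\<close>

definition realization :: "'a cell set \<Rightarrow> 'o \<times> ('a cell \<Rightarrow> 'a)" where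
  "realization S = (SOME Re. finite_CW C I (fst Re) \<and> realizes S (fst Re) (snd Re))"

abbreviation "R S \<equiv> fst (realization S)"
abbreviation "e S \<equiv> snd (realization S)"

text \<open>Fixing one enumeration of \<open>S\<close> makes a cell a function of \<open>S\<close>,
  \<open>i\<close>, \<open>a\<close> and \<open>b\<close>, on which the counting of cells relies.
  Storing the maps \<open>e S d\<close> lets \<open>family\<close> speak about the boundary without
  mentioning \<open>realization\<close>.\<close>

definition boundary :: "'a cell set \<Rightarrow> ('a cell \<times> 'a) list" where
  "boundary S = map (\<lambda>d. (d, e S d)) (SOME ds. set ds = S)"

text \<open>A cell is a lifting problem: \<open>m\<close> is the map from \<open>R S\<close> to
  \<open>Y\<close> given by the cells of \<open>S\<close>, and the last premise says that the square
  with sides \<open>i\<close> and \<open>m\<close> commutes. The first two premises unfold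
  membership of \<open>S\<close> in \<open>complexes\<close>, which is itself defined from
  \<open>cells\<close>.\<close>

inductive_set cells :: "'a cell set" where
  "\<lbrakk>finite S; \<forall>c\<in>S. c \<in> cells \<and> bds c \<subseteq> S; i \<in> I; a \<in> hom C (src C i) (R S); b \<in> hom C (tgt C i) Y;
    m \<in> hom C (R S) Y; \<forall>d\<in>S. m \<cdot> e S d = chr d; m \<cdot> a = b \<cdot> i\<rbrakk>
    \<Longrightarrow> Cell (boundary S) i a b \<in> cells"

definition complexes :: "'a cell set set" where
  "complexes = {S. finite S \<and> S \<subseteq> cells \<and> (\<forall>c\<in>S. bds c \<subseteq> S)}"

lemma complexesD:
  assumes "S \<in> complexes"
  shows "finite S" "c \<in> S \<Longrightarrow> c \<in> cells" "c \<in> S \<Longrightarrow> bds c \<subseteq> S"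
  using assms by (auto simp: complexes_def)

lemma set_boundary: "finite S \<Longrightarrow> set (boundary S) = (\<lambda>d. (d, e S d)) ` S"
  using someI_ex[OF finite_list[of S]] by (simp add: boundary_def)

lemma cells_iff:
  "c \<in> cells \<longleftrightarrow> (\<exists>S\<in>complexes. \<exists>i\<in>I. \<exists>a\<in>hom C (src C i) (R S). \<exists>b\<in>hom C (tgt C i) Y.
    \<exists>m\<in>hom C (R S) Y. c = Cell (boundary S) i a b \<and> (\<forall>d\<in>S. m \<cdot> e S d = chr d) \<and> m \<cdot> a = b \<cdot> i)"
    (is "_ \<longleftrightarrow> ?r")
proof
  assume "c \<in> cells"
  then show ?r
  proof cases
    case (1 S i a b m)
    have "S \<in> complexes" using 1(2,3) by (auto simp: complexes_def)
    with 1 show ?thesis by blast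
  qed
next
  assume ?r
  then obtain S i a b m where S: "S \<in> complexes" and *: "i \<in> I" "a \<in> hom C (src C i) (R S)"
    "b \<in> hom C (tgt C i) Y" "m \<in> hom C (R S) Y" "\<forall>d\<in>S. m \<cdot> e S d = chr d" "m \<cdot> a = b \<cdot> i"
    and c: "c = Cell (boundary S) i a b"
    by blast
  show "c \<in> cells"
    unfolding c by (rule cells.intros[OF _ _ *]) (use complexesD[OF S] in auto)
qed

lemma bds_Cell: "S \<in> complexes \<Longrightarrow> bds (Cell (boundary S) i a b) = S"
  by (simp add: bds_def set_boundary[OF complexesD(1)] image_image)

text \<open>Split off a last cell \<open>c\<close> and attach it by a pushout to a realization of
  the rest. A map out of this pushout is a family on the other cells together with a value at
  \<open>c\<close> compatible with the attaching map, and this compatibility is the condition of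
  \<open>family\<close> at \<open>c\<close>.\<close>

lemma realization_exists:
  assumes "S \<in> complexes"
  shows "\<exists>Q q. finite_CW C I Q \<and> realizes S Q q"
  using assms
proof (induction "card S" arbitrary: S rule: less_induct)
  case less
  show ?case
  proof (cases "S = {}")
    case True
    obtain Z where Z: "initial C Z" using initial_exists[OF size_cardinal cocomplete] .
    then have "realizes S Z undefined"
      by (auto simp: True realizes_def family_def initial_def)
    then show ?thesis using finite_CW_initial[OF Z] by blast
  next
    case False
    note S = complexesD[OF less.prems]
    \<comment> \<open>Boundaries consist of strictly smaller cells, so a cell of maximal size lies
      in no boundary of a cell of \<open>S\<close> and can be attached last.\<close>
    obtain c where c: "c \<in> S" "\<And>d. d \<in> S \<Longrightarrow> size d \<le> size c"
      using finite_has_maximal[of "size ` S"] S(1) False by (auto simp: not_le) (metis linorder_le_cases)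
    define S' where "S' = S - {c}"
    have S'_closed: "bds d \<subseteq> S'" if "d \<in> S'" for d
      using S(3)[of d] size_bds[of c d] c(2)[of d] that by (auto simp: S'_def)
    then have S': "S' \<in> complexes"
      using S by (auto simp: S'_def complexes_def)
    have card': "card S' < card S"
      unfolding S'_def using S(1) c(1) by (rule card_Diff1_less)
    obtain T i a b where T: "T \<in> complexes" and i: "i \<in> I" and a: "a \<in> hom C (src C i) (R T)"
      and b: "b \<in> hom C (tgt C i) Y" and c_eq: "c = Cell (boundary T) i a b"
      using S(2)[OF c(1)] unfolding cells_iff by blast
    have bds_c: "bds c = T" using bds_Cell[OF T] by (simp add: c_eq)
    have TS': "T \<subseteq> S'" using S(3)[OF c(1)] size_bds[of c c] by (auto simp: S'_def bds_c)
    \<comment> \<open>The attaching map ends in the chosen object \<open>R T\<close>, which is known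
      to realize \<open>T\<close> only by a second use of the induction hypothesis. Hence the
      induction on the number of cells instead of the removal of one cell.\<close>
    have "card T < card S"
      using card_mono[OF complexesD(1)[OF S'] TS'] card' by simp
    then have RT: "realizes T (R T) (e T)"
      unfolding realization_def using less.hyps[OF _ T] someI_ex[of "\<lambda>Re. finite_CW C I (fst Re) \<and> realizes T (fst Re) (snd Re)"]
      by auto
    obtain Q q where Q: "finite_CW C I Q" "realizes S' Q q"
      using less.hyps[OF card' S'] by blast
    note Qfam = realizes_family[OF Q(2)]
    obtain m where m: "m \<in> hom C (R T) Q" "\<And>d. d \<in> T \<Longrightarrow> m \<cdot> e T d = q d"
      using realizes_factor[OF RT family_subset[OF Qfam TS']] by blast
    have i': "i \<in> hom C (src C i) (tgt C i)" using hom_self i I by blast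
    obtain f h Q' where po: "is_pushout C i f (m \<cdot> a) h" and f: "f \<in> hom C Q Q'"
      and h: "h \<in> hom C (tgt C i) Q'"
      using pushout_exists[OF size_cardinal cocomplete i' cmp_in_hom[OF a m(1)]] .
    \<comment> \<open>The old characteristic maps are pushed along \<open>f\<close>; the new cell
      gets the other leg \<open>h\<close> of the pushout.\<close>
    define x where "x d = (if d = c then h else f \<cdot> q d)" for d
    have S_eq: "S = insert c S'" using c(1) by (auto simp: S'_def)
    have [simp]: "gen c = i" "att c = a" "set (bd c) = (\<lambda>d. (d, e T d)) ` T" "tgt C a = R T"
      using a set_boundary[OF complexesD(1)[OF T]] by (auto simp: c_eq hom_def)
    have eT: "e T d \<in> hom C (tgt C (gen d)) (R T)" if "d \<in> T" for d
      using family_hom[OF realizes_family[OF RT] that] .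
    have xS': "x d = f \<cdot> q d" if "d \<in> S'" for d using that by (auto simp: x_def S'_def)
    have fam': "family S' Q' x"
      by (rule family_cong[OF family_comp[OF Qfam f]]) (use S'_closed xS' in auto)
    have x_fam: "family S Q' x"
      unfolding family_def S_eq
    proof (intro conjI ball_simps(7)[THEN iffD2])
      show "Q' \<in> Ob C" using hom_tgt[OF f] .
      show "gen c \<in> Mor C" "att c \<in> hom C (src C (gen c)) (tgt C (att c))"
        "x c \<in> hom C (tgt C (gen c)) Q'" using i I a h by (auto simp: x_def)
      show "\<exists>m\<in>hom C (tgt C (att c)) Q'. m \<cdot> att c = x c \<cdot> gen c \<and>
          (\<forall>(d, e)\<in>set (bd c). e \<in> hom C (tgt C (gen d)) (tgt C (att c)) \<and> m \<cdot> e = x d)"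
      proof (intro bexI[of _ "f \<cdot> m"] conjI)
        show "f \<cdot> m \<in> hom C (tgt C (att c)) Q'" using cmp_in_hom[OF m(1) f] by simp
        show "(f \<cdot> m) \<cdot> att c = x c \<cdot> gen c"
          using is_pushoutD(5)[OF po] cmp_assoc[OF a m(1) f] by (simp add: x_def)
        have "(f \<cdot> m) \<cdot> e T d = x d" if "d \<in> T" for d
          using cmp_assoc[OF eT[OF that] m(1) f] m(2)[OF that] xS' TS' that by auto
        then show "\<forall>(d, e)\<in>set (bd c). e \<in> hom C (tgt C (gen d)) (tgt C (att c)) \<and> (f \<cdot> m) \<cdot> e = x d"
          using eT by simp
      qed
    qed (use fam' in \<open>simp add: family_def\<close>)
    have "\<exists>!t. t \<in> hom C Q' X \<and> (\<forall>d\<in>S. t \<cdot> x d = y d)" if y: "family S X y" for X y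
    proof -
      obtain p where p: "p \<in> hom C Q X" "\<And>d. d \<in> S' \<Longrightarrow> p \<cdot> q d = y d"
        using realizes_factor[OF Q(2) family_subset[OF y]] by (auto simp: S'_def)
      have yc: "y c \<in> hom C (tgt C i) X" using family_hom[OF y c(1)] by simp
      obtain m' where m': "m' \<in> hom C (R T) X" "m' \<cdot> a = y c \<cdot> i" "\<And>d. d \<in> T \<Longrightarrow> m' \<cdot> e T d = y d"
        using y c(1) unfolding family_def by fastforce
      \<comment> \<open>The family \<open>y\<close> provides \<open>m'\<close> on \<open>R T\<close>
        at the cell \<open>c\<close>. It agrees with \<open>p \<cdot> m\<close> on the cells of
        \<open>T\<close>, so the two are equal, and \<open>p\<close> and \<open>y c\<close> become
        compatible over the pushout.\<close>
      have "p \<cdot> m = m'"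
      proof (rule realizes_unique[OF RT cmp_in_hom[OF m(1) p(1)] m'(1)])
        fix d assume "d \<in> T"
        then show "(p \<cdot> m) \<cdot> e T d = m' \<cdot> e T d"
          using cmp_assoc[OF eT m(1) p(1)] m(2) p(2) m'(3) TS' by auto
      qed
      then have "p \<cdot> (m \<cdot> a) = y c \<cdot> i"
        using m'(2) cmp_assoc[OF a m(1) p(1)] by simp
      moreover have st: "src C f = Q" "tgt C f = Q'" using f by (auto simp: hom_def)
      ultimately obtain t where t: "t \<in> hom C Q' X" "t \<cdot> f = p" "t \<cdot> h = y c"
        using pushout_factor[OF po, of p X "y c"] p(1) yc by auto
      have qd: "q d \<in> hom C (tgt C (gen d)) Q" if "d \<in> S'" for d
        using family_hom[OF Qfam that] .
      show ?thesis
      proof (rule ex1I[of _ t])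
        show "t \<in> hom C Q' X \<and> (\<forall>d\<in>S. t \<cdot> x d = y d)"
          using t p(2) cmp_assoc[OF qd f t(1)] xS' unfolding S_eq by (auto simp: x_def)
      next
        fix t' assume t': "t' \<in> hom C Q' X \<and> (\<forall>d\<in>S. t' \<cdot> x d = y d)"
        then have t'X: "t' \<in> hom C Q' X" by blast
        have "t' \<cdot> f = p"
        proof (rule realizes_unique[OF Q(2) cmp_in_hom[OF f t'X] p(1)])
          fix d assume d: "d \<in> S'"
          then show "(t' \<cdot> f) \<cdot> q d = p \<cdot> q d"
            using cmp_assoc[OF qd[OF d] f t'X] t' xS'[OF d] p(2)[OF d] unfolding S_eq by auto
        qed
        moreover have "t' \<cdot> h = y c" using t' c(1) by (auto simp: x_def)
        ultimately show "t' = t"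
          using pushout_unique[OF po, of t' X t] t t'X st by simp
      qed
    qed
    then have "realizes S Q' x" using x_fam unfolding realizes_def by blast
    then show ?thesis using finite_CW_attach[OF Q(1) i po f] by blast
  qed
qed

lemma realization:
  assumes "S \<in> complexes"
  shows "finite_CW C I (R S)" "realizes S (R S) (e S)"
proof -
  have "\<exists>Re. finite_CW C I (fst Re) \<and> realizes S (fst Re) (snd Re)"
    using realization_exists[OF assms] by simp
  from someI_ex[OF this] show "finite_CW C I (R S)" "realizes S (R S) (e S)"
    by (simp_all only: realization_def)
qed

lemma chr_family:
  assumes S: "S \<in> complexes"
  shows "family S Y chr"
  unfolding family_def
proof (intro conjI ballI)
  show "Y \<in> Ob C" by (rule Y)
  fix c assume "c \<in> S"
  then have "c \<in> cells" by (rule complexesD(2)[OF S])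
  then obtain T i a b m where T: "T \<in> complexes" and i: "i \<in> I" and a: "a \<in> hom C (src C i) (R T)"
    and b: "b \<in> hom C (tgt C i) Y" and m: "m \<in> hom C (R T) Y" "\<And>d. d \<in> T \<Longrightarrow> m \<cdot> e T d = chr d"
      "m \<cdot> a = b \<cdot> i" and c: "c = Cell (boundary T) i a b"
    unfolding cells_iff by blast
  have [simp]: "gen c = i" "att c = a" "chr c = b" "set (bd c) = (\<lambda>d. (d, e T d)) ` T" "tgt C a = R T"
    using a set_boundary[OF complexesD(1)[OF T]] by (auto simp: c hom_def)
  show "gen c \<in> Mor C" "att c \<in> hom C (src C (gen c)) (tgt C (att c))" "chr c \<in> hom C (tgt C (gen c)) Y"
    using i I a b by auto
  show "\<exists>m\<in>hom C (tgt C (att c)) Y. m \<cdot> att c = chr c \<cdot> gen c \<and>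
      (\<forall>(d, e)\<in>set (bd c). e \<in> hom C (tgt C (gen d)) (tgt C (att c)) \<and> m \<cdot> e = chr d)"
    using m family_hom[OF realizes_family[OF realization(2)[OF T]]] by (intro bexI[of _ m]) auto
qed

lemma Un_complexes: "S \<in> complexes \<Longrightarrow> T \<in> complexes \<Longrightarrow> S \<union> T \<in> complexes"
  by (auto simp: complexes_def)

section \<open>Counting cells and complexes\<close>

lemma small_hom: "|hom C A B| <o \<kappa>"
proof (cases "hom C A B = {}")
  case True
  then show ?thesis using small_finite[OF size_cardinal, of "hom C A B"] by simp
next
  case False
  then show ?thesis using locally_small hom_src hom_tgt unfolding locally_small_def by blast
qed

text \<open>Stratify by size. A cell of size below \<open>Suc n\<close> is given by a finite set of
  cells of size below \<open>n\<close>, an element of \<open>I\<close> and two arrows from small hom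
  sets; the countable union of these layers is small.\<close>

lemma small_cells: "|cells| <o \<kappa>"
proof -
  have K: "|{c \<in> cells. size c < n}| <o \<kappa>" for n
  proof (induction n)
    case 0
    then show ?case using small_finite[OF size_cardinal, of "{c \<in> cells. size c < 0}"] by simp
  next
    case (Suc n)
    let ?F = "{T. T \<subseteq> {c \<in> cells. size c < n} \<and> finite T}"
    have "{c \<in> cells. size c < Suc n} \<subseteq> (\<Union>T\<in>?F. \<Union>i\<in>I. \<Union>a\<in>hom C (src C i) (R T).
        (\<lambda>b. Cell (boundary T) i a b) ` hom C (tgt C i) Y)"
    proof clarify
      fix c assume c: "c \<in> cells" "size c < Suc n"
      then obtain T i a b where T: "T \<in> complexes" and iab: "i \<in> I" "a \<in> hom C (src C i) (R T)"
          "b \<in> hom C (tgt C i) Y" and c_eq: "c = Cell (boundary T) i a b"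
        unfolding cells_iff by blast
      have "size d < n" if "d \<in> T" for d
        using size_bds[of d c] that c(2) bds_Cell[OF T] by (simp add: c_eq)
      then have "T \<in> ?F" using complexesD[OF T] by auto
      then show "c \<in> (\<Union>T\<in>?F. \<Union>i\<in>I. \<Union>a\<in>hom C (src C i) (R T).
          (\<lambda>b. Cell (boundary T) i a b) ` hom C (tgt C i) Y)"
        using iab c_eq by blast
    qed
    then show ?case
      by (rule small_subset)
        (rule small_UN[OF size_cardinal small_Fpow[OF size_cardinal Suc.IH]],
         rule small_UN[OF size_cardinal I(2)], rule small_UN[OF size_cardinal small_hom],
         rule small_image[OF small_hom])
  qed
  have "cells \<subseteq> (\<Union>n. {c \<in> cells. size c < n})" by auto
  then show ?thesis
    by (rule small_subset) (rule small_UN[OF size_cardinal small_nat[OF size_cardinal] K])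
qed

lemma small_complexes: "|complexes| <o \<kappa>"
  by (rule small_subset[OF _ small_Fpow[OF size_cardinal small_cells]]) (auto simp: complexes_def)

section \<open>The directed diagram of realizations and its cocone to \<open>Y\<close>\<close>

definition incl :: "'a cell set rel" where
  "incl = {(S, T). S \<in> complexes \<and> T \<in> complexes \<and> S \<subseteq> T}"

text \<open>On \<open>incl\<close> exactly one map satisfies the condition, by the universal
  property of \<open>R S\<close>. Functoriality therefore only has to be checked on characteristic
  maps.\<close>

definition \<phi> :: "'a cell set \<times> 'a cell set \<Rightarrow> 'a" where
  "\<phi> = (\<lambda>(S, T). SOME m. m \<in> hom C (R S) (R T) \<and> (\<forall>c\<in>S. m \<cdot> e S c = e T c))"

lemma Field_incl: "Field incl = complexes"
  by (auto simp: incl_def Field_def)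

lemma e_hom: "S \<in> complexes \<Longrightarrow> c \<in> S \<Longrightarrow> e S c \<in> hom C (tgt C (gen c)) (R S)"
  by (rule family_hom[OF realizes_family[OF realization(2)]])

lemma \<phi>:
  assumes "(S, T) \<in> incl"
  shows "\<phi> (S, T) \<in> hom C (R S) (R T)" "c \<in> S \<Longrightarrow> \<phi> (S, T) \<cdot> e S c = e T c"
proof -
  have ST: "S \<in> complexes" "T \<in> complexes" "S \<subseteq> T" using assms by (auto simp: incl_def)
  have "family S (R T) (e T)"
    using family_subset[OF realizes_family[OF realization(2)[OF ST(2)]] ST(3)] .
  then have "\<exists>m. m \<in> hom C (R S) (R T) \<and> (\<forall>c\<in>S. m \<cdot> e S c = e T c)"
    using realizes_factor[OF realization(2)[OF ST(1)]] by metis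
  from someI_ex[OF this] show "\<phi> (S, T) \<in> hom C (R S) (R T)" "c \<in> S \<Longrightarrow> \<phi> (S, T) \<cdot> e S c = e T c"
    by (auto simp: \<phi>_def)
qed

lemma small_incl: "small_category \<kappa> (order_cat incl)"
  unfolding small_category_def order_cat_simps Field_incl
proof (intro conjI)
  show "category (order_cat incl)"
    by (rule category_order_cat) (auto simp: refl_on_def Field_incl trans_def, auto simp: incl_def)
  show "|complexes| <o \<kappa>" by (rule small_complexes)
  have "incl \<subseteq> (\<Union>S\<in>complexes. Pair S ` complexes)" by (auto simp: incl_def)
  then show "|incl| <o \<kappa>"
    by (rule small_subset) (rule small_UN[OF size_cardinal small_complexes], rule small_image[OF small_complexes])
qed

lemma filtered_incl: "filtered (order_cat incl)"
proof (rule filtered_order_cat)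
  show "Refl incl" by (auto simp: refl_on_def Field_incl) (auto simp: incl_def)
  show "Field incl \<noteq> {}" by (auto simp: Field_incl complexes_def)
  show "\<exists>U. (S, U) \<in> incl \<and> (T, U) \<in> incl" if "S \<in> Field incl" "T \<in> Field incl" for S T
    using that[unfolded Field_incl] Un_complexes by (intro exI[of _ "S \<union> T"]) (auto simp: incl_def)
qed

lemma functor_realization: "cat_functor (order_cat incl) C R \<phi>"
proof (rule cat_functor_order_cat)
  fix S assume "S \<in> Field incl"
  then have S: "S \<in> complexes" "(S, S) \<in> incl" unfolding Field_incl by (auto simp: incl_def)
  have ob: "R S \<in> Ob C" using family_Ob[OF realizes_family[OF realization(2)[OF S(1)]]] .
  have "\<phi> (S, S) = ide C (R S)"
    by (rule realizes_unique[OF realization(2)[OF S(1)] \<phi>(1)[OF S(2)] ide_in_hom[OF ob]])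
      (simp add: \<phi>(2)[OF S(2)] ide_cmp[OF e_hom[OF S(1)]])
  with ob show "R S \<in> Ob C \<and> \<phi> (S, S) = ide C (R S)" by blast
next
  show "\<phi> (S, T) \<in> hom C (R S) (R T)" if "(S, T) \<in> incl" for S T
    using \<phi>(1)[OF that] .
next
  fix S T U assume ST: "(S, T) \<in> incl" and TU: "(T, U) \<in> incl"
  then have SU: "(S, U) \<in> incl" and S: "S \<in> complexes" and sub: "S \<subseteq> T" by (auto simp: incl_def)
  show "\<phi> (S, U) = \<phi> (T, U) \<cdot> \<phi> (S, T)"
  proof (rule realizes_unique[OF realization(2)[OF S] \<phi>(1)[OF SU] cmp_in_hom[OF \<phi>(1)[OF ST] \<phi>(1)[OF TU]]])
    fix c assume c: "c \<in> S"
    then show "\<phi> (S, U) \<cdot> e S c = (\<phi> (T, U) \<cdot> \<phi> (S, T)) \<cdot> e S c"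
      using cmp_assoc[OF e_hom[OF S c] \<phi>(1)[OF ST] \<phi>(1)[OF TU]] \<phi>(2) ST TU SU sub by auto
  qed
qed

definition \<pi> :: "'a cell set \<Rightarrow> 'a" where
  "\<pi> S = (SOME m. m \<in> hom C (R S) Y \<and> (\<forall>c\<in>S. m \<cdot> e S c = chr c))"

lemma \<pi>:
  assumes S: "S \<in> complexes"
  shows "\<pi> S \<in> hom C (R S) Y" "c \<in> S \<Longrightarrow> \<pi> S \<cdot> e S c = chr c"
proof -
  have "\<exists>m. m \<in> hom C (R S) Y \<and> (\<forall>c\<in>S. m \<cdot> e S c = chr c)"
    using realizes_factor[OF realization(2)[OF S] chr_family[OF S]] by metis
  from someI_ex[OF this] show "\<pi> S \<in> hom C (R S) Y" "c \<in> S \<Longrightarrow> \<pi> S \<cdot> e S c = chr c"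
    by (auto simp: \<pi>_def)
qed

lemma \<pi>_cocone: "cocone (order_cat incl) C R \<phi> Y \<pi>"
proof -
  have "\<pi> T \<cdot> \<phi> (S, T) = \<pi> S" if ST: "(S, T) \<in> incl" for S T
  proof -
    have S: "S \<in> complexes" and T: "T \<in> complexes" and sub: "S \<subseteq> T" using ST by (auto simp: incl_def)
    show ?thesis
    proof (rule realizes_unique[OF realization(2)[OF S] cmp_in_hom[OF \<phi>(1)[OF ST] \<pi>(1)[OF T]] \<pi>(1)[OF S]])
      fix c assume c: "c \<in> S"
      then show "(\<pi> T \<cdot> \<phi> (S, T)) \<cdot> e S c = \<pi> S \<cdot> e S c"
        using cmp_assoc[OF e_hom[OF S c] \<phi>(1)[OF ST] \<pi>(1)[OF T]] \<phi>(2)[OF ST] \<pi>(2) S T sub by auto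
    qed
  qed
  then show ?thesis
    using Y \<pi>(1) unfolding cocone_order_cat Field_incl by blast
qed

text \<open>The problem is itself a cell \<open>c\<close> with boundary \<open>S\<close>, so
  \<open>insert c S\<close> is again a complex, and the characteristic map of \<open>c\<close> in
  its realization is the lift.\<close>

lemma attach_cell:
  assumes S: "S \<in> complexes" and i: "i \<in> I" and a: "a \<in> hom C (src C i) (R S)"
    and b: "b \<in> hom C (tgt C i) Y" and eq: "\<pi> S \<cdot> a = b \<cdot> i"
  obtains T h where "(S, T) \<in> incl" "h \<in> hom C (tgt C i) (R T)" "h \<cdot> i = \<phi> (S, T) \<cdot> a" "\<pi> T \<cdot> h = b"
proof -
  define c where "c = Cell (boundary S) i a b"
  define T where "T = insert c S"
  have "c \<in> cells"
    using S i a b eq \<pi>[OF S] unfolding cells_iff c_def by blast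
  then have T: "T \<in> complexes"
    using S bds_Cell[OF S, of i a b] by (auto simp: complexes_def T_def c_def[symmetric])
  then have ST: "(S, T) \<in> incl" using S by (auto simp: incl_def T_def)
  have cT: "c \<in> T" by (simp add: T_def)
  have [simp]: "gen c = i" "att c = a" "chr c = b" "set (bd c) = (\<lambda>d. (d, e S d)) ` S" "tgt C a = R S"
    using a set_boundary[OF complexesD(1)[OF S]] by (auto simp: c_def hom_def)
  obtain m where m: "m \<in> hom C (R S) (R T)" "m \<cdot> a = e T c \<cdot> i" "\<And>d. d \<in> S \<Longrightarrow> m \<cdot> e S d = e T d"
    using realizes_family[OF realization(2)[OF T]] cT unfolding family_def by fastforce
  \<comment> \<open>The family condition at \<open>c\<close> only asserts that some extension
    \<open>m\<close> to \<open>R S\<close> exists; its values on the cells of \<open>S\<close>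
    identify it with the transition map.\<close>
  have "m = \<phi> (S, T)"
    by (rule realizes_unique[OF realization(2)[OF S] m(1) \<phi>(1)[OF ST]]) (simp add: m \<phi>(2)[OF ST])
  then show ?thesis
    using that[OF ST, of "e T c"] m(2) e_hom[OF T cT] \<pi>(2)[OF T cT] by simp
qed

section \<open>The right lifting property of the colimit, and the retract\<close>

lemma acyclic_fibration_from_complexes:
  assumes fin: "\<And>i. i \<in> I \<Longrightarrow> categorically_finite \<kappa> C (src C i)"
  obtains L \<iota> P where "is_colimit (order_cat incl) C R \<phi> L \<iota>" "P \<in> hom C L Y"
    "\<And>S. S \<in> complexes \<Longrightarrow> P \<cdot> \<iota> S = \<pi> S" "\<And>i. i \<in> I \<Longrightarrow> has_lift C i P"
proof -
  obtain L \<iota> where L: "is_colimit (order_cat incl) C R \<phi> L \<iota>"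
    using cocomplete_colimit[OF size_cardinal cocomplete small_incl functor_realization] .
  note cone = is_colimit_cocone[OF L, unfolded cocone_order_cat Field_incl]
  have \<iota>: "\<iota> S \<in> hom C (R S) L" if "S \<in> complexes" for S using cone that by blast
  have \<iota>\<phi>: "\<iota> T \<cdot> \<phi> (S, T) = \<iota> S" if "(S, T) \<in> incl" for S T using cone that by blast
  obtain P where P: "P \<in> hom C L Y" and P\<iota>: "\<And>S. S \<in> complexes \<Longrightarrow> P \<cdot> \<iota> S = \<pi> S"
    using L \<pi>_cocone unfolding is_colimit_def order_cat_simps Field_incl by blast
  have "has_lift C i P" if i: "i \<in> I" for i
    unfolding has_lift_def
  proof (intro ballI impI)
    fix u v assume "u \<in> hom C (src C i) (src C P)" and "v \<in> hom C (tgt C i) (tgt C P)" and sq: "P \<cdot> u = v \<cdot> i"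
    then have u: "u \<in> hom C (src C i) L" and v: "v \<in> hom C (tgt C i) Y" using P by (auto simp: hom_def)
    have i': "i \<in> hom C (src C i) (tgt C i)" using hom_self i I by blast
    obtain S a where S: "S \<in> complexes" and a: "a \<in> hom C (src C i) (R S)" and au: "\<iota> S \<cdot> a = u"
      using categorically_finite_surj[OF size_cardinal fin[OF i] small_incl filtered_incl functor_realization L u]
      by (auto simp: Field_incl)
    have "\<pi> S \<cdot> a = v \<cdot> i"
      using cmp_assoc[OF a \<iota>[OF S] P] by (simp add: P\<iota>[OF S] au sq)
    then obtain T h where T: "(S, T) \<in> incl" and h: "h \<in> hom C (tgt C i) (R T)" "h \<cdot> i = \<phi> (S, T) \<cdot> a"
        "\<pi> T \<cdot> h = v"
      using attach_cell[OF S i a v] by blast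
    have T': "T \<in> complexes" using T by (simp add: incl_def)
    have "(\<iota> T \<cdot> h) \<cdot> i = u"
      using cmp_assoc[OF i' h(1) \<iota>[OF T']] cmp_assoc[OF a \<phi>(1)[OF T] \<iota>[OF T']]
      by (simp add: h \<iota>\<phi>[OF T] au)
    moreover have "P \<cdot> (\<iota> T \<cdot> h) = v"
      using cmp_assoc[OF h(1) \<iota>[OF T'] P] by (simp add: P\<iota>[OF T'] h)
    ultimately show "\<exists>h\<in>hom C (tgt C i) (src C P). h \<cdot> i = u \<and> P \<cdot> h = v"
      using cmp_in_hom[OF h(1) \<iota>[OF T']] P by (auto simp: hom_def)
  qed
  then show ?thesis using that L P P\<iota> by blast
qed

text \<open>The assumption \<open>sec\<close> is the only place where the model structure and
  cofibrancy of \<open>Y\<close> will be supplied. Factoring the section through a stage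
  \<open>S\<close> turns \<open>P \<cdot> s = ide C Y\<close> into a retraction by
  \<open>\<pi> S\<close>.\<close>

lemma retract_of_complex:
  assumes fin: "\<And>i. i \<in> I \<Longrightarrow> categorically_finite \<kappa> C (src C i)"
    and Y_fin: "categorically_finite \<kappa> C Y"
    and sec: "\<And>L P. P \<in> hom C L Y \<Longrightarrow> \<forall>i\<in>I. has_lift C i P \<Longrightarrow> \<exists>s\<in>hom C Y L. P \<cdot> s = ide C Y"
  shows "\<exists>Z. finite_CW C I Z \<and> retract C Y Z"
proof -
  obtain L \<iota> P where L: "is_colimit (order_cat incl) C R \<phi> L \<iota>" and P: "P \<in> hom C L Y"
    and P\<iota>: "\<And>S. S \<in> complexes \<Longrightarrow> P \<cdot> \<iota> S = \<pi> S" and lift: "\<And>i. i \<in> I \<Longrightarrow> has_lift C i P"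
    using acyclic_fibration_from_complexes[OF fin] by blast
  obtain s where s: "s \<in> hom C Y L" "P \<cdot> s = ide C Y" using sec[OF P] lift by blast
  obtain S t where S: "S \<in> complexes" and t: "t \<in> hom C Y (R S)" "\<iota> S \<cdot> t = s"
    using categorically_finite_surj[OF size_cardinal Y_fin small_incl filtered_incl functor_realization L s(1)]
    by (auto simp: Field_incl)
  have \<iota>: "\<iota> S \<in> hom C (R S) L"
    using is_colimit_cocone[OF L] S unfolding cocone_order_cat Field_incl by blast
  have "\<pi> S \<cdot> t = ide C Y"
    using cmp_assoc[OF t(1) \<iota> P] s(2) by (simp add: P\<iota>[OF S] t(2))
  then have "retract C Y (R S)"
    using Y t(1) \<pi>(1)[OF S] hom_tgt[OF t(1)] unfolding retract_def by blast
  then show ?thesis using realization(1)[OF S] by blast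
qed

end


theorem theorem2p1p1:
  fixes \<kappa> :: "'k rel" and C :: "('o, 'a) cat" and W Cof Fib I :: "'a set" and Y :: 'o
  assumes "size_cardinal \<kappa>"
    and "model_category \<kappa> C W Cof Fib"
    and "generating_cofibrations \<kappa> C W Fib I"
    and "\<forall>i\<in>I. categorically_finite \<kappa> C (src C i)"
    and "Y \<in> Ob C"
  shows "(categorically_finite \<kappa> C Y \<and> cofibrant C Cof Y \<longrightarrow>
            (\<exists>Z. finite_CW C I Z \<and> retract C Y Z)) \<and>
         ((\<exists>Z. finite_CW C I Z \<and> retract C Y Z) \<and>
            (\<forall>i\<in>I. categorically_finite \<kappa> C (src C i) \<and> categorically_finite \<kappa> C (tgt C i)) \<longrightarrow>
            categorically_finite \<kappa> C Y \<and> cofibrant C Cof Y)"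
proof -
  interpret model_category \<kappa> C W Cof Fib by fact
  have I: "I \<subseteq> Mor C" "|I| <o \<kappa>" and WF: "W \<inter> Fib = {p \<in> Mor C. \<forall>i\<in>I. has_lift C i p}"
    using assms(3) by (auto simp: generating_cofibrations_def)
  show ?thesis
  proof (intro conjI impI)
    assume fin_cof: "categorically_finite \<kappa> C Y \<and> cofibrant C Cof Y"
    interpret complexes_over C \<kappa> I Y
      by unfold_locales (use assms I cocomplete locally_small in auto)
    obtain Z f where Z: "initial C Z" and f: "f \<in> hom C Z Y" "f \<in> Cof"
      using fin_cof unfolding cofibrant_def by blast
    show "\<exists>Z. finite_CW C I Z \<and> retract C Y Z"
    proof (rule retract_of_complex)
      fix L P assume P: "P \<in> hom C L Y" and "\<forall>i\<in>I. has_lift C i P"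
      then have "P \<in> W \<inter> Fib" unfolding WF by (simp add: hom_def)
      then have lift: "has_lift C f P" using lifting_acyclic_fibration f(2) by blast
      have st: "src C f = Z" "tgt C f = Y" "src C P = L" "tgt C P = Y"
        using f P by (auto simp: hom_def)
      obtain u where u: "u \<in> hom C Z L" using initial_map[OF Z hom_src[OF P]] .
      \<comment> \<open>The section is a lift of the identity of \<open>Y\<close>; the square
        commutes because both composites start at the initial object.\<close>
      have "P \<cdot>\<^bsub>C\<^esub> u = ide C Y \<cdot>\<^bsub>C\<^esub> f"
        using initial_unique[OF Z cmp_in_hom[OF u P]] f(1) ide_cmp[OF f(1)] by simp
      then show "\<exists>s\<in>hom C Y L. P \<cdot>\<^bsub>C\<^esub> s = ide C Y"
        using lift u ide_in_hom[OF assms(5)] unfolding has_lift_def st by blast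
    qed (use assms(4) fin_cof in auto)
  next
    assume *: "(\<exists>Z. finite_CW C I Z \<and> retract C Y Z) \<and>
        (\<forall>i\<in>I. categorically_finite \<kappa> C (src C i) \<and> categorically_finite \<kappa> C (tgt C i))"
    then obtain Z where Z: "finite_CW C I Z" "retract C Y Z" by blast
    have gen: "has_lift C i p" if "i \<in> I" "p \<in> W \<inter> Fib" for i p using that unfolding WF by blast
    show "categorically_finite \<kappa> C Y" "cofibrant C Cof Y"
      using retract_finite_CW[OF gen Z] * by blast+
  qed
qed

end
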